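(* Let $M$ be a $C^2$ complete convex surface in $\mathbb{R}^3$ with bounded Gaussian curvature $K$ satisfying $K>K_1$ for a positive constant $K_1$, and let $r_i$ be its injectivity radius. Let $A^{\circ}B^{\circ}C^{\circ}D^{\circ}$ be a convex quadrilateral contained in a subset of a geodesic disc of radius $r_i$ of $M$, with perimeter smaller than $2r_i$, and let positive weights $w_{A^\circ},w_{B^\circ},w_{C^\circ},w_{D^\circ}$ be chosen so that the corresponding weighted Fermat-Torricelli point $P_F$ lies in the interior of $A^{\circ}B^{\circ}C^{\circ}D^{\circ}$. For $R\in\{A,B,C,D\}$ let $R'$ be the point of the tangent plane $T_{P_F}(M)$ (with $P_F$ as origin) on the ray tangent at $P_F$ to the geodesic arc $P_FR^\circ$ with $|P_FR'|=w_{R^\circ}$; that is, $R'=\exp_{P_F}^{-1}(R)$, where $R$ lies on the geodesic $P_FR^{\circ}$ and $|P_FR|=|\exp_{P_F}^{-1}(R)|=|P_FR'|=w_{R}$, with $w_R=w_{R^\circ}$. Let $A'^{\star}$ and $C'^{\star}$ be the points symmetric to $A'$ and $C'$ with respect to $P_F$ in $T_{P_F}(M)$. Then $A'^{\star}B'C'^{\star}D'$ is a parallelogram.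
   Context: A convex surface is the whole boundary of a convex body in $\mathbb{R}^3$. A convex quadrilateral $A^\circ B^\circ C^\circ D^\circ$ has vertices in this cyclic order and sides that are shortest arcs. For positive weights attached to the vertices, the weighted Fermat-Torricelli point $P_F$ is the point of $M$ minimizing $f(P)=\sum_{R^\circ}w_{R^\circ}l_{R^\circ}$, where $l_{R^\circ}$ is the length of the geodesic (shortest) arc from $P$ to the vertex $R^\circ\in\{A^\circ,B^\circ,C^\circ,D^\circ\}$. The map $\exp_{P_F}$ is the exponential map of $M$ at $P_F$. The injectivity radius of $M$ is $r_i=\inf\{r_i(P):P\in M\}$. *)

theory Defs
  imports "HOL-Analysis.Analysis"
begin

unbundle cross3_syntax

text \<open>A convex body is a closed convex set with nonempty interior. Boundedness is not required here;
  for the surfaces of the theorem it follows from the positive lower curvature bound.\<close>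

definition convex_surface :: "(real^3) set \<Rightarrow> bool" where
  "convex_surface M \<longleftrightarrow> (\<exists>S. convex S \<and> closed S \<and> interior S \<noteq> {} \<and> M = frontier S)"

definition C2_chart ::
  "(real^3) set \<Rightarrow> (real^2) set \<Rightarrow> (real^2 \<Rightarrow> real^3) \<Rightarrow> (real^2 \<Rightarrow> (real^2) \<Rightarrow>\<^sub>L (real^3))
    \<Rightarrow> (real^2 \<Rightarrow> (real^2) \<Rightarrow>\<^sub>L (real^2) \<Rightarrow>\<^sub>L (real^3)) \<Rightarrow> bool" where
  "C2_chart M U X X' X'' \<longleftrightarrow>
     open U \<and>
     (\<forall>x\<in>U. (X has_derivative blinfun_apply (X' x)) (at x)) \<and>
     (\<forall>x\<in>U. (X' has_derivative blinfun_apply (X'' x)) (at x)) \<and>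
     continuous_on U X'' \<and>
     (\<forall>x\<in>U. inj (blinfun_apply (X' x))) \<and>
     (\<exists>Y. homeomorphism U (X ` U) X Y) \<and>
     openin (top_of_set M) (X ` U)"

definition C2_surface :: "(real^3) set \<Rightarrow> bool" where
  "C2_surface M \<longleftrightarrow> (\<forall>p\<in>M. \<exists>U X X' X''. C2_chart M U X X' X'' \<and> p \<in> X ` U)"

text \<open>Determinant of the second fundamental form divided by that of the first, in a chart with first
  and second derivative \<open>X'\<close>, \<open>X''\<close>.\<close>

definition chart_curvature ::
  "(real^2 \<Rightarrow> (real^2) \<Rightarrow>\<^sub>L (real^3)) \<Rightarrow> (real^2 \<Rightarrow> (real^2) \<Rightarrow>\<^sub>L (real^2) \<Rightarrow>\<^sub>L (real^3)) \<Rightarrow> real^2 \<Rightarrow> real" where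
  "chart_curvature X' X'' x =
     (let e1 = axis 1 1; e2 = axis 2 1;
          Xu = X' x e1; Xv = X' x e2;
          n = (Xu \<times> Xv) /\<^sub>R norm (Xu \<times> Xv);
          h11 = X'' x e1 e1 \<bullet> n; h12 = X'' x e1 e2 \<bullet> n; h22 = X'' x e2 e2 \<bullet> n
      in (h11 * h22 - h12\<^sup>2) / ((Xu \<bullet> Xu) * (Xv \<bullet> Xv) - (Xu \<bullet> Xv)\<^sup>2))"

text \<open>The value does not depend on the chart, so the description is proper on a C2 surface.\<close>

definition gauss_curvature :: "(real^3) set \<Rightarrow> real^3 \<Rightarrow> real" where
  "gauss_curvature M p =
     (THE k. \<exists>U X X' X'' x. C2_chart M U X X' X'' \<and> x \<in> U \<and> X x = p \<and> k = chart_curvature X' X'' x)"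

text \<open>Velocity vectors at \<open>p\<close> of curves in \<open>M\<close>: the tangent plane with \<open>p\<close> as origin.\<close>

definition tangent_plane :: "(real^3) set \<Rightarrow> real^3 \<Rightarrow> (real^3) set" where
  "tangent_plane M p =
     {v. \<exists>c e. e > 0 \<and> c ` {-e<..<e} \<subseteq> M \<and> c 0 = p \<and> (c has_vector_derivative v) (at 0)}"

text \<open>Supremum of the lengths of inscribed polygons.\<close>

definition curve_length :: "(real \<Rightarrow> real^3) \<Rightarrow> ennreal" where
  "curve_length g =
     (SUP ts \<in> {ts. sorted ts \<and> set ts \<subseteq> {0..1}}.
        \<Sum>i<length ts - 1. ennreal (dist (g (ts ! i)) (g (ts ! Suc i))))"

definition geodist :: "(real^3) set \<Rightarrow> real^3 \<Rightarrow> real^3 \<Rightarrow> ennreal" where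
  "geodist M p q =
     (INF g \<in> {g. path g \<and> path_image g \<subseteq> M \<and> pathstart g = p \<and> pathfinish g = q}. curve_length g)"

text \<open>Shortest arcs are parametrized by arc length on \<open>{0..l}\<close>, i.e. they are the isometric embeddings
  of intervals with respect to the intrinsic metric.\<close>

definition shortest_arc ::
  "(real^3) set \<Rightarrow> (real \<Rightarrow> real^3) \<Rightarrow> real \<Rightarrow> real^3 \<Rightarrow> real^3 \<Rightarrow> bool" where
  "shortest_arc M g l p q \<longleftrightarrow>
     0 \<le> l \<and> g ` {0..l} \<subseteq> M \<and> g 0 = p \<and> g l = q \<and>
     (\<forall>s\<in>{0..l}. \<forall>t\<in>{0..l}. geodist M (g s) (g t) = ennreal \<bar>s - t\<bar>)"

text \<open>A geodesic is a locally shortest curve; here it is parametrized on \<open>{0..1}\<close> with constant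
  speed \<open>norm v\<close>, where \<open>v\<close> is its initial velocity.\<close>

definition geodesic_from :: "(real^3) set \<Rightarrow> real^3 \<Rightarrow> real^3 \<Rightarrow> (real \<Rightarrow> real^3) \<Rightarrow> bool" where
  "geodesic_from M p v c \<longleftrightarrow>
     c ` {0..1} \<subseteq> M \<and> c 0 = p \<and> (c has_vector_derivative v) (at 0 within {0..1}) \<and>
     (\<forall>t\<in>{0..1}. \<exists>e>0. \<forall>s\<in>{0..1} \<inter> ball t e. \<forall>s'\<in>{0..1} \<inter> ball t e.
        geodist M (c s) (c s') = ennreal (norm v * \<bar>s - s'\<bar>))"

definition exp_graph :: "(real^3) set \<Rightarrow> real^3 \<Rightarrow> real^3 \<Rightarrow> real^3 \<Rightarrow> bool" where
  "exp_graph M p v q \<longleftrightarrow> (\<exists>c. geodesic_from M p v c \<and> c 1 = q)"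

definition exp_map :: "(real^3) set \<Rightarrow> real^3 \<Rightarrow> real^3 \<Rightarrow> real^3" where
  "exp_map M p v = (THE q. exp_graph M p v q)"

text \<open>The surface is only of class C2, so its metric is C1 and the exponential map need not be
  differentiable; ``diffeomorphism onto the image'' is therefore read as ``homeomorphism onto the
  image''. The radii are extended reals, so that suprema and infima need no side conditions.\<close>

definition normal_radius :: "(real^3) set \<Rightarrow> real^3 \<Rightarrow> real \<Rightarrow> bool" where
  "normal_radius M p r \<longleftrightarrow>
     (let B = {v \<in> tangent_plane M p. norm v < r}
      in (\<forall>v\<in>B. \<exists>!q. exp_graph M p v q) \<and>
         (\<exists>h. homeomorphism B (exp_map M p ` B) (exp_map M p) h))"

definition injectivity_radius_at :: "(real^3) set \<Rightarrow> real^3 \<Rightarrow> ennreal" where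
  "injectivity_radius_at M p = (SUP r \<in> {r. 0 < r \<and> normal_radius M p r}. ennreal r)"

definition injectivity_radius :: "(real^3) set \<Rightarrow> ennreal" where
  "injectivity_radius M = (INF p\<in>M. injectivity_radius_at M p)"

definition geodesic_disc :: "(real^3) set \<Rightarrow> real^3 \<Rightarrow> ennreal \<Rightarrow> (real^3) set" where
  "geodesic_disc M p r = {q \<in> M. geodist M p q \<le> r}"

definition geodesically_convex :: "(real^3) set \<Rightarrow> (real^3) set \<Rightarrow> bool" where
  "geodesically_convex M Q \<longleftrightarrow>
     (\<forall>p\<in>Q. \<forall>q\<in>Q. \<exists>g l. shortest_arc M g l p q \<and> g ` {0..l} \<subseteq> Q)"

text \<open>\<open>Q\<close> is the closed region; its boundary in \<open>M\<close> is the simple closed curve formed by shortest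
  arcs \<open>ab\<close>, \<open>bc\<close>, \<open>cd\<close>, \<open>da\<close>.\<close>

definition convex_quadrilateral ::
  "(real^3) set \<Rightarrow> (real^3) set \<Rightarrow> real^3 \<Rightarrow> real^3 \<Rightarrow> real^3 \<Rightarrow> real^3 \<Rightarrow> bool" where
  "convex_quadrilateral M Q a b c d \<longleftrightarrow>
     closedin (top_of_set M) Q \<and> geodesically_convex M Q \<and> distinct [a, b, c, d] \<and>
     (\<exists>gab lab gbc lbc gcd lcd gda lda.
        shortest_arc M gab lab a b \<and> shortest_arc M gbc lbc b c \<and>
        shortest_arc M gcd lcd c d \<and> shortest_arc M gda lda d a \<and>
        (let AB = gab ` {0..lab}; BC = gbc ` {0..lbc}; CD = gcd ` {0..lcd}; DA = gda ` {0..lda}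
         in DA \<inter> AB = {a} \<and> AB \<inter> BC = {b} \<and> BC \<inter> CD = {c} \<and> CD \<inter> DA = {d} \<and>
            AB \<inter> CD = {} \<and> BC \<inter> DA = {} \<and>
            top_of_set M frontier_of Q = AB \<union> BC \<union> CD \<union> DA))"

definition perimeter :: "(real^3) set \<Rightarrow> real^3 \<Rightarrow> real^3 \<Rightarrow> real^3 \<Rightarrow> real^3 \<Rightarrow> ennreal" where
  "perimeter M a b c d = geodist M a b + geodist M b c + geodist M c d + geodist M d a"

definition FT_function ::
  "(real^3) set \<Rightarrow> real^3 \<Rightarrow> real^3 \<Rightarrow> real^3 \<Rightarrow> real^3 \<Rightarrow> real \<Rightarrow> real \<Rightarrow> real \<Rightarrow> real \<Rightarrow> real^3 \<Rightarrow> ennreal"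
  where
  "FT_function M a b c d wa wb wc wd p =
     ennreal wa * geodist M p a + ennreal wb * geodist M p b +
     ennreal wc * geodist M p c + ennreal wd * geodist M p d"

definition FT_point ::
  "(real^3) set \<Rightarrow> real^3 \<Rightarrow> real^3 \<Rightarrow> real^3 \<Rightarrow> real^3 \<Rightarrow> real \<Rightarrow> real \<Rightarrow> real \<Rightarrow> real \<Rightarrow> real^3 \<Rightarrow> bool"
  where
  "FT_point M a b c d wa wb wc wd p \<longleftrightarrow>
     p \<in> M \<and> (\<forall>q\<in>M. FT_function M a b c d wa wb wc wd p \<le> FT_function M a b c d wa wb wc wd q)"

text \<open>\<open>v\<close> is the point of the tangent plane at \<open>p\<close> at distance \<open>w\<close> from the origin on the ray tangent
  to the shortest arc from \<open>p\<close> to \<open>r\<close>. It is the preimage under the exponential map of the point at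
  distance \<open>w\<close> along the geodesic; see the two lemmas below.\<close>

definition tangent_ray_point ::
  "(real^3) set \<Rightarrow> real^3 \<Rightarrow> real^3 \<Rightarrow> real \<Rightarrow> real^3 \<Rightarrow> bool" where
  "tangent_ray_point M p r w v \<longleftrightarrow>
     v \<in> tangent_plane M p \<and> norm v = w \<and>
     (\<exists>g l u. shortest_arc M g l p r \<and> 0 < l \<and> (g has_vector_derivative u) (at 0 within {0..l}) \<and>
        (\<exists>t\<ge>0. v = t *\<^sub>R u))"

lemma shortest_arc_exp_graph:
  assumes g: "shortest_arc M g l p r" and l: "0 < l"
    and u: "(g has_vector_derivative u) (at 0 within {0..l})" and nu: "norm u = 1"
    and w: "0 < w" "w \<le> l"
  shows "exp_graph M p (w *\<^sub>R u) (g w)"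
proof -
  define c where "c = (\<lambda>t. g (w * t))"
  have img: "w * t \<in> {0..l}" if "t \<in> {0..1}" for t
  proof -
    have "w * t \<le> w * 1" using that w by (intro mult_left_mono) auto
    then have "w * t \<le> l" using w by linarith
    then show ?thesis using that w by auto
  qed
  have der: "(c has_vector_derivative w *\<^sub>R u) (at 0 within {0..1})"
  proof -
    have 1: "((\<lambda>t. w * t) has_vector_derivative w) (at 0 within {0..1})"
      by (auto intro!: derivative_eq_intros)
    have "(\<lambda>t. w * t) ` {0..1} \<subseteq> {0..l}" using img by auto
    then have 2: "(g has_vector_derivative u) (at (w * 0) within (\<lambda>t. w * t) ` {0..1})"
      using u by (auto intro: has_vector_derivative_within_subset)
    show ?thesis using vector_diff_chain_within[OF 1 2] by (simp add: c_def o_def)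
  qed
  have gd: "geodist M (c s) (c s') = ennreal (norm (w *\<^sub>R u) * \<bar>s - s'\<bar>)"
    if s: "s \<in> {0..1}" "s' \<in> {0..1}" for s s'
  proof -
    have "\<bar>w * s - w * s'\<bar> = w * \<bar>s - s'\<bar>"
      using w by (simp add: abs_mult flip: right_diff_distrib)
    moreover have "geodist M (c s) (c s') = ennreal \<bar>w * s - w * s'\<bar>"
      using g img[OF s(1)] img[OF s(2)] unfolding shortest_arc_def c_def by blast
    ultimately show ?thesis using w nu by simp
  qed
  have "\<forall>t\<in>{0..1}. \<exists>e>0. \<forall>s\<in>{0..1} \<inter> ball t e. \<forall>s'\<in>{0..1} \<inter> ball t e.
        geodist M (c s) (c s') = ennreal (norm (w *\<^sub>R u) * \<bar>s - s'\<bar>)"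
    using gd by (intro ballI exI[of _ 1]) auto
  moreover have "c ` {0..1} \<subseteq> M"
    using g img unfolding shortest_arc_def c_def by blast
  moreover have "c 0 = p" using g by (simp add: c_def shortest_arc_def)
  ultimately have "geodesic_from M p (w *\<^sub>R u) c"
    using der by (simp add: geodesic_from_def)
  then show ?thesis unfolding exp_graph_def by (intro exI[of _ c]) (simp add: c_def)
qed

lemma exp_map_tangent_ray:
  assumes "shortest_arc M g l p r" "0 < l" "(g has_vector_derivative u) (at 0 within {0..l})"
    and "norm u = 1" "0 < w" "w \<le> l"
    and "w *\<^sub>R u \<in> tangent_plane M p" "normal_radius M p \<rho>" "w < \<rho>"
  shows "exp_map M p (w *\<^sub>R u) = g w"
    and "inv_into {v \<in> tangent_plane M p. norm v < \<rho>} (exp_map M p) (g w) = w *\<^sub>R u"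
proof -
  let ?B = "{v \<in> tangent_plane M p. norm v < \<rho>}"
  have B: "w *\<^sub>R u \<in> ?B" using assms by simp
  have "exp_graph M p (w *\<^sub>R u) (g w)" using assms shortest_arc_exp_graph by blast
  moreover have "\<exists>!q. exp_graph M p (w *\<^sub>R u) q"
    using assms(8) B unfolding normal_radius_def Let_def by blast
  ultimately show e: "exp_map M p (w *\<^sub>R u) = g w"
    unfolding exp_map_def by (blast intro: the1_equality)
  have "inj_on (exp_map M p) ?B"
    using assms(8) unfolding normal_radius_def Let_def homeomorphism_def inj_on_def by metis
  then show "inv_into ?B (exp_map M p) (g w) = w *\<^sub>R u"
    using inv_into_f_f[OF _ B, of "exp_map M p"] e by simp
qed

definition parallelogram :: "real^3 \<Rightarrow> real^3 \<Rightarrow> real^3 \<Rightarrow> real^3 \<Rightarrow> bool" where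
  "parallelogram a b c d \<longleftrightarrow> \<not> collinear {a, b, c} \<and> b - a = c - d"

end

theory Submission
  imports Defs
begin

text \<open>
  Let \<open>P\<close> be the minimizer, write \<open>A'\<close>, \<open>B'\<close>, \<open>C'\<close>, \<open>D'\<close> for the weighted initial directions at \<open>P\<close> of the arcs
  to the vertices. The sides \<open>B' + A'\<close> and \<open>- C' - D'\<close> of the figure agree exactly if the four vectors have sum zero, and the
  figure is a genuine parallelogram if moreover \<open>A' + B'\<close> and \<open>B' + C'\<close> are not parallel.

  The vanishing of the sum is the first order condition at a minimum (lemma \<open>FT_point_tangent_sum_eq_0\<close>). The distance to a
  vertex varies along a curve with velocity \<open>v\<close> at most at the rate \<open>- (u \<bullet> v)\<close>, where \<open>u\<close> is the unit initial direction of
  the shortest arc (\<open>first_variation_le\<close>); taking for \<open>v\<close> the sum itself would decrease the weighted distance. The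
  geometry of the surface enters through one estimate: nearby points satisfy
  \<open>geodist M x y \<le> norm (y - x) + C * (norm (y - x))\<^sup>2\<close> (\<open>geodist_le_chord_locally\<close>). It also shows that shortest arcs have
  an initial direction (\<open>shortest_arc_initial_direction\<close>).

  Suppose that the sum vanishes and the figure is degenerate. Then there is a normal vector in the tangent plane over which
  \<open>A'\<close> and \<open>C'\<close> have the same height \<open>h\<close> and \<open>B'\<close> and \<open>D'\<close> the height \<open>- h\<close>. So either all four directions lie on one
  line, or a line through \<open>P\<close> separates the directions to opposite vertices \<open>A\<close>, \<open>C\<close> from those to \<open>B\<close>, \<open>D\<close>. Both
  contradict the following description of the boundary of the quadrilateral: the direction from \<open>P\<close> is a homeomorphism
  from the boundary onto the unit circle (\<open>boundary_radial_homeomorphism\<close>). Indeed the vertices have four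
  distinct directions, so that not all of them lie on a line, and they follow each other on the circle in the
  order \<open>A\<close>, \<open>B\<close>, \<open>C\<close>, \<open>D\<close> (\<open>circle_order_not_separated\<close>).

  For the description of the boundary, polar coordinates are taken with centre \<open>P\<close> and with centre at boundary points. Two
  boundary points are at most half of the perimeter apart, which is less than the injectivity radius. This makes
  the whole region fit into each of these coordinate discs (\<open>radius_bound\<close>). There the only shortest arcs from the
  centre are the radii (\<open>arc_to_E\<close>), so a convex region is star-shaped, and the arc from a boundary point to an interior
  point runs in the interior (\<open>arc_to_interior\<close>); hence each ray from \<open>P\<close> crosses the boundary exactly once.
\<close>

section \<open>Intrinsic distance\<close>

fun polygon_length :: "'a::metric_space list \<Rightarrow> ennreal" where
  "polygon_length (x # y # zs) = ennreal (dist x y) + polygon_length (y # zs)"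
| "polygon_length _ = 0"

lemma sum_dist_eq_polygon_length:
  "(\<Sum>i<length ts - 1. ennreal (dist (g (ts ! i)) (g (ts ! Suc i)))) = polygon_length (map g ts)"
proof (induction ts)
  case (Cons t ts)
  then show ?case
    by (cases ts) (simp_all add: sum.lessThan_Suc_shift del: sum.lessThan_Suc sum_ennreal)
qed simp

lemma curve_length_polygon:
  "curve_length g = (SUP ts \<in> {ts. sorted ts \<and> set ts \<subseteq> {0..1}}. polygon_length (map g ts))"
  unfolding curve_length_def sum_dist_eq_polygon_length ..

text \<open>By the triangle inequality, routing a polygon through a further point \<open>m\<close> does not shorten it. It is
  used at the junction of two curves.\<close>

lemma polygon_length_append:
  "polygon_length (xs @ ys) \<le> polygon_length (xs @ [m]) + polygon_length (m # ys)"
proof (induction xs rule: polygon_length.induct)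
  case (1 x y zs)
  then show ?case by (simp add: add.assoc add_left_mono)
next
  case "2_1"
  then show ?case by (cases ys) auto
next
  case ("2_2" x)
  show ?case
  proof (cases ys)
    case (Cons y zs)
    have "ennreal (dist x y) \<le> ennreal (dist x m) + ennreal (dist m y)"
      by (simp add: dist_triangle flip: ennreal_plus)
    then show ?thesis using Cons by (simp add: add_right_mono flip: add.assoc)
  qed simp
qed

lemma sorted_dropWhile_gt:
  fixes c :: "'a::linorder"
  shows "sorted ts \<Longrightarrow> t \<in> set (dropWhile (\<lambda>t. t \<le> c) ts) \<Longrightarrow> c < t"
  by (induction ts) (auto split: if_splits)

text \<open>An inscribed polygon of the joined curve is cut at parameter \<open>1/2\<close>; inserting the junction there gives
  one polygon inscribed in each part.\<close>

lemma curve_length_join: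
  assumes "pathfinish g = pathstart h"
  shows "curve_length (g +++ h) \<le> curve_length g + curve_length h"
  unfolding curve_length_polygon[of "g +++ h"]
proof (rule SUP_least, clarify)
  fix ts :: "real list" assume ts: "sorted ts" "set ts \<subseteq> {0..1}"
  define xs where "xs = takeWhile (\<lambda>t. t \<le> 1/2) ts"
  define ys where "ys = dropWhile (\<lambda>t. t \<le> 1/2) ts"
  have eq: "ts = xs @ ys" by (simp add: xs_def ys_def)
  have xs: "sorted xs" "\<And>t. t \<in> set xs \<Longrightarrow> 0 \<le> t \<and> t \<le> 1/2"
    using ts unfolding xs_def by (auto simp: sorted_takeWhile dest!: set_takeWhileD)
  have ys_mem: "t \<in> set ts" "1/2 < t" if "t \<in> set ys" for t
    using that sorted_dropWhile_gt[OF ts(1)] unfolding ys_def by (blast dest: set_dropWhileD)+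
  have ys: "sorted ys" "\<And>t. t \<in> set ys \<Longrightarrow> 1/2 < t \<and> t \<le> 1"
    using sorted_dropWhile[OF ts(1)] ys_mem ts(2) unfolding ys_def by (simp, fastforce)
  have "map (g +++ h) (xs @ [1/2]) = map g (map (\<lambda>t. 2 * t) (xs @ [1/2]))"
    using xs(2) by (auto simp: joinpaths_def)
  moreover have "sorted (map (\<lambda>t. 2 * t) (xs @ [1/2]))"
    using xs by (auto simp: sorted_append sorted_map mult.commute)
  moreover have "set (map (\<lambda>t. 2 * t) (xs @ [1/2])) \<subseteq> {0..1}"
    using xs(2) by fastforce
  ultimately have 1: "polygon_length (map (g +++ h) (xs @ [1/2])) \<le> curve_length g"
    unfolding curve_length_polygon by (metis (mono_tags, lifting) SUP_upper mem_Collect_eq)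
  have ys_gt: "\<not> t * 2 \<le> 1" "1 \<le> t * 2" "0 \<le> 2 * t - 1" "t \<le> 1" if "t \<in> set ys" for t
    using ys(2)[OF that] by auto
  have "map (g +++ h) (1/2 # ys) = map h (map (\<lambda>t. 2 * t - 1) (1/2 # ys))"
    using ys_gt assms by (auto simp: joinpaths_def pathstart_def pathfinish_def)
  moreover have "sorted (map (\<lambda>t. 2 * t - 1) (1/2 # ys))"
    using ys(1) ys_gt by (auto simp: sorted_map mult.commute)
  moreover have "set (map (\<lambda>t. 2 * t - 1) (1/2 # ys)) \<subseteq> {0..1}"
    using ys_gt by (auto simp: mult.commute)
  ultimately have 2: "polygon_length (map (g +++ h) (1/2 # ys)) \<le> curve_length h"
    unfolding curve_length_polygon by (metis (mono_tags, lifting) SUP_upper mem_Collect_eq)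
  have "polygon_length (map (g +++ h) ts)
      \<le> polygon_length (map (g +++ h) (xs @ [1/2])) + polygon_length (map (g +++ h) (1/2 # ys))"
    using polygon_length_append[of "map (g +++ h) xs" "map (g +++ h) ys" "(g +++ h) (1/2)"]
    by (simp add: eq)
  also have "\<dots> \<le> curve_length g + curve_length h" using 1 2 by (rule add_mono)
  finally show "polygon_length (map (g +++ h) ts) \<le> curve_length g + curve_length h" .
qed

lemma ennreal_le_add_INF:
  fixes c z :: ennreal
  assumes "\<And>x. x \<in> A \<Longrightarrow> z \<le> c + f x"
  shows "z \<le> c + (INF x\<in>A. f x)"
proof (cases "c = top")
  case False
  then have "z - c \<le> f x" if "x \<in> A" for x
    using assms[OF that] by (simp add: ennreal_minus_le_iff)
  then have "z - c \<le> (INF x\<in>A. f x)" by (rule INF_greatest)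
  then show ?thesis using False by (simp add: ennreal_minus_le_iff)
qed simp

lemma geodist_triangle: "geodist M p r \<le> geodist M p q + geodist M q r"
proof -
  let ?\<P> = "\<lambda>p q. {g. path g \<and> path_image g \<subseteq> M \<and> pathstart g = p \<and> pathfinish g = q}"
  have "geodist M p r \<le> curve_length g + curve_length h" if "g \<in> ?\<P> p q" "h \<in> ?\<P> q r" for g h
  proof -
    have "g +++ h \<in> ?\<P> p r" using that by (auto simp: path_image_join)
    then have "geodist M p r \<le> curve_length (g +++ h)" unfolding geodist_def by (rule INF_lower)
    also have "\<dots> \<le> curve_length g + curve_length h" using that by (intro curve_length_join) auto
    finally show ?thesis .
  qed
  then have "geodist M p r \<le> curve_length g + geodist M q r" if "g \<in> ?\<P> p q" for g
    using that unfolding geodist_def[of M q] by (intro ennreal_le_add_INF) auto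
  then show ?thesis
    unfolding geodist_def[of M p q] by (subst add.commute, intro ennreal_le_add_INF) (auto simp: add.commute)
qed

lemma geodist_triangle_le:
  assumes "geodist M p q \<le> ennreal a" "geodist M q r \<le> ennreal b" "0 \<le> a" "0 \<le> b"
  shows "geodist M p r \<le> ennreal (a + b)"
  using order_trans[OF geodist_triangle add_mono[OF assms(1,2)]] assms(3,4) by simp

text \<open>The chord is the inscribed polygon with vertices at the two ends.\<close>

lemma dist_le_geodist: "ennreal (dist p q) \<le> geodist M p q"
  unfolding geodist_def
proof (rule INF_greatest, clarify)
  fix g :: "real \<Rightarrow> real^3"
  show "ennreal (dist (pathstart g) (pathfinish g)) \<le> curve_length g"
    unfolding curve_length_polygon by (rule SUP_upper2[of "[0, 1]"]) (auto simp: pathstart_def pathfinish_def)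
qed

lemma curve_length_Lipschitz:
  assumes "\<And>s t. 0 \<le> s \<Longrightarrow> s \<le> t \<Longrightarrow> t \<le> 1 \<Longrightarrow> dist (g s) (g t) \<le> L * (t - s)" and "0 \<le> L"
  shows "curve_length g \<le> ennreal L"
  unfolding curve_length_def
proof (rule SUP_least, clarify)
  fix ts :: "real list" assume ts: "sorted ts" "set ts \<subseteq> {0..1}"
  let ?n = "length ts - 1"
  have mem: "0 \<le> ts ! i \<and> ts ! i \<le> 1" if "i < length ts" for i
    using ts(2) nth_mem[OF that] by auto
  have "(\<Sum>i<?n. dist (g (ts ! i)) (g (ts ! Suc i))) \<le> (\<Sum>i<?n. L * (ts ! Suc i - ts ! i))"
  proof (rule sum_mono)
    fix i assume "i \<in> {..<?n}"
    then show "dist (g (ts ! i)) (g (ts ! Suc i)) \<le> L * (ts ! Suc i - ts ! i)"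
      using mem[of i] mem[of "Suc i"] ts(1) by (intro assms(1)) (auto simp: sorted_iff_nth_mono)
  qed
  also have "\<dots> = L * (ts ! ?n - ts ! 0)"
    by (simp add: sum_lessThan_telescope flip: sum_distrib_left)
  also have "\<dots> \<le> L"
  proof (cases "ts = []")
    case False
    then show ?thesis using mem[of ?n] mem[of 0] assms(2) mult_left_mono[of "ts ! ?n - ts ! 0" 1 L] by auto
  qed (use assms(2) in simp)
  finally show "(\<Sum>i<?n. ennreal (dist (g (ts ! i)) (g (ts ! Suc i)))) \<le> ennreal L"
    by (simp add: sum_ennreal ennreal_leI)
qed

lemma geodist_refl: "p \<in> M \<Longrightarrow> geodist M p p = 0"
proof -
  assume "p \<in> M"
  then have "geodist M p p \<le> curve_length (\<lambda>_. p)"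
    unfolding geodist_def by (intro INF_lower) (auto simp: path_def path_image_def pathstart_def pathfinish_def)
  also have "\<dots> \<le> ennreal 0" by (rule curve_length_Lipschitz) auto
  finally show ?thesis by simp
qed

section \<open>Charts of a surface of class C2\<close>

lemma norm_diff_le_of_closed_segment:
  fixes a b :: "'a::real_normed_vector"
  assumes "y \<in> closed_segment a b" "z \<in> closed_segment a b"
  shows "norm (y - z) \<le> norm (b - a)"
proof -
  obtain s t where "0 \<le> s" "s \<le> 1" "0 \<le> t" "t \<le> 1"
    and y: "y = (1 - s) *\<^sub>R a + s *\<^sub>R b" and z: "z = (1 - t) *\<^sub>R a + t *\<^sub>R b"
    using assms by (auto simp: closed_segment_def)
  moreover have "y - z = (s - t) *\<^sub>R (b - a)" unfolding y z by (simp add: algebra_simps)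
  ultimately show ?thesis by (auto intro!: mult_left_le_one_le)
qed

text \<open>Near a point, the second derivative is bounded by a constant \<open>K\<close>, so the first derivative is \<open>K\<close>-Lipschitz.
  The mean value inequality turns this into a quadratic error of the linear approximation taken at any point \<open>z\<close> of the
  segment, not only at an end. The injective derivative at the centre stretches by at least some \<open>\<kappa>0\<close>, and on a small ball
  half of this factor survives for the chart itself.\<close>

lemma C2_chart_local_bounds:
  assumes X: "C2_chart M U X X' X''" and x0: "x0 \<in> U"
  obtains \<epsilon> K \<kappa> where "0 < \<epsilon>" "0 < K" "0 < \<kappa>" "ball x0 \<epsilon> \<subseteq> U"
    "\<And>a b z. a \<in> ball x0 \<epsilon> \<Longrightarrow> b \<in> ball x0 \<epsilon> \<Longrightarrow> z \<in> closed_segment a b \<Longrightarrow>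
        norm (X b - X a - X' z (b - a)) \<le> K * (norm (b - a))\<^sup>2"
    "\<And>a b. a \<in> ball x0 \<epsilon> \<Longrightarrow> b \<in> ball x0 \<epsilon> \<Longrightarrow> \<kappa> * norm (b - a) \<le> norm (X b - X a)"
proof -
  have U: "open U" and dX: "\<And>x. x \<in> U \<Longrightarrow> (X has_derivative X' x) (at x)"
    and dX': "\<And>x. x \<in> U \<Longrightarrow> (X' has_derivative X'' x) (at x)"
    and cX'': "continuous_on U X''" and inj: "inj (X' x0)"
    using X x0 unfolding C2_chart_def by auto
  define K where "K = norm (X'' x0) + 1"
  have K: "0 < K" unfolding K_def by (simp add: add_nonneg_pos)
  have "isCont X'' x0" using cX'' U x0 continuous_on_eq_continuous_at by blast
  then obtain d1 where d1: "0 < d1" "\<And>z. dist z x0 < d1 \<Longrightarrow> dist (X'' z) (X'' x0) < 1"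
    unfolding continuous_at_eps_delta by (metis zero_less_one)
  obtain d2 where d2: "0 < d2" "ball x0 d2 \<subseteq> U" using U x0 openE by blast
  obtain \<kappa>0 where \<kappa>0: "0 < \<kappa>0" "\<And>\<xi>. \<kappa>0 * norm \<xi> \<le> norm (X' x0 \<xi>)"
    using linear_inj_bounded_below_pos[OF bounded_linear.linear[OF blinfun.bounded_linear_right] inj]
    by metis
  \<comment> \<open>the last bound keeps the derivative within \<open>\<kappa>0 / 2\<close> of the derivative at the centre\<close>
  define \<epsilon> where "\<epsilon> = min (min d1 d2) (\<kappa>0 / (2 * K))"
  have \<epsilon>: "0 < \<epsilon>" "\<epsilon> \<le> d1" "\<epsilon> \<le> d2" "\<epsilon> \<le> \<kappa>0 / (2 * K)" using d1 d2 \<kappa>0 K by (auto simp: \<epsilon>_def)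
  have sub: "ball x0 \<epsilon> \<subseteq> U" using d2 \<epsilon> by (meson subset_ball order_trans)
  have Lip: "norm (X' a - X' b) \<le> K * norm (a - b)" if "a \<in> ball x0 \<epsilon>" "b \<in> ball x0 \<epsilon>" for a b
  proof (rule differentiable_bound[OF convex_ball _ _ that])
    fix z assume z: "z \<in> ball x0 \<epsilon>"
    show "(X' has_derivative X'' z) (at z within ball x0 \<epsilon>)"
      using dX' sub z by (blast intro: has_derivative_at_withinI)
    have "dist (X'' z) (X'' x0) < 1" using d1(2)[of z] \<epsilon> z by (simp add: dist_commute)
    then have "norm (X'' z) \<le> K" unfolding K_def
      by (smt (verit) dist_norm norm_triangle_sub)
    then show "onorm (X'' z) \<le> K" by (simp add: norm_blinfun.rep_eq)
  qed
  have dlin: "((\<lambda>y. X y - X' z y) has_derivative blinfun_apply (X' y - X' z)) (at y within S)"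
    if "y \<in> U" for y z S
    using that by (auto intro!: derivative_eq_intros has_derivative_at_withinI[OF dX] simp: blinfun.diff_left)
  have quad: "norm (X b - X a - X' z (b - a)) \<le> K * (norm (b - a))\<^sup>2"
    if ab: "a \<in> ball x0 \<epsilon>" "b \<in> ball x0 \<epsilon>" and z: "z \<in> closed_segment a b" for a b z
  proof -
    have seg: "closed_segment a b \<subseteq> ball x0 \<epsilon>" using ab by (simp add: closed_segment_subset)
    have "norm ((X b - X' z b) - (X a - X' z a)) \<le> K * norm (b - a) * norm (b - a)"
    proof (rule differentiable_bound[of "closed_segment a b" _ "\<lambda>y. blinfun_apply (X' y - X' z)"])
      fix y assume y: "y \<in> closed_segment a b"
      show "((\<lambda>y. X y - X' z y) has_derivative blinfun_apply (X' y - X' z)) (at y within closed_segment a b)"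
        using dlin seg sub y by blast
      have "norm (X' y - X' z) \<le> K * norm (y - z)" using seg y z by (intro Lip) auto
      also have "\<dots> \<le> K * norm (b - a)"
        using K y z by (intro mult_left_mono) (auto intro: norm_diff_le_of_closed_segment)
      finally show "onorm (blinfun_apply (X' y - X' z)) \<le> K * norm (b - a)"
        by (simp add: norm_blinfun.rep_eq)
    qed auto
    then show ?thesis by (simp add: blinfun.diff_right power2_eq_square algebra_simps)
  qed
  have below: "\<kappa>0 / 2 * norm (b - a) \<le> norm (X b - X a)"
    if ab: "a \<in> ball x0 \<epsilon>" "b \<in> ball x0 \<epsilon>" for a b
  proof -
    have "norm ((X b - X' x0 b) - (X a - X' x0 a)) \<le> \<kappa>0 / 2 * norm (b - a)"
    proof (rule differentiable_bound[of "ball x0 \<epsilon>" _ "\<lambda>y. blinfun_apply (X' y - X' x0)"])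
      fix y assume y: "y \<in> ball x0 \<epsilon>"
      show "((\<lambda>y. X y - X' x0 y) has_derivative blinfun_apply (X' y - X' x0)) (at y within ball x0 \<epsilon>)"
        using dlin sub y by blast
      have "norm (X' y - X' x0) \<le> K * norm (y - x0)" using y \<epsilon> by (intro Lip) auto
      also have "\<dots> \<le> K * (\<kappa>0 / (2 * K))"
        using K y \<epsilon>(4) by (intro mult_left_mono) (auto simp: dist_norm norm_minus_commute)
      also have "\<dots> = \<kappa>0 / 2" using K by simp
      finally show "onorm (blinfun_apply (X' y - X' x0)) \<le> \<kappa>0 / 2"
        by (simp add: norm_blinfun.rep_eq)
    qed (use ab in auto)
    moreover have "norm (X' x0 (b - a)) \<le> norm (X b - X a) + norm ((X b - X' x0 b) - (X a - X' x0 a))"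
      using norm_triangle_ineq4[of "X b - X a" "(X b - X' x0 b) - (X a - X' x0 a)"]
      by (simp add: blinfun.diff_right algebra_simps)
    ultimately show ?thesis using \<kappa>0(2)[of "b - a"] by linarith
  qed
  show thesis by (rule that[OF \<epsilon>(1) K _ sub quad below]) (use \<kappa>0 in auto)
qed

lemma C2_chart_open_image:
  assumes X: "C2_chart M U X X' X''" and "V \<subseteq> U" "open V"
  shows "openin (top_of_set M) (X ` V)"
proof -
  obtain Y where "homeomorphism U (X ` U) X Y" and o: "openin (top_of_set M) (X ` U)"
    using X unfolding C2_chart_def by blast
  then have "openin (top_of_set (X ` U)) (X ` V)"
    using homeomorphism_imp_open_map[of U "X ` U" X Y V] assms(2,3) by (simp add: open_subset)
  then show ?thesis using o openin_trans by blast
qed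

text \<open>The two estimates of a chart around \<open>p\<close>, together with a ball of the ambient space in which the chart
  covers the surface. They are stated with bounded quantifiers, so that they can be passed on as single facts.\<close>

lemma C2_surface_chart_ball:
  assumes "C2_surface M" "p \<in> M"
  obtains U X X' X'' x0 \<epsilon> K \<kappa> \<delta> where "C2_chart M U X X' X''" "x0 \<in> U" "X x0 = p"
    "0 < \<epsilon>" "0 < K" "0 < \<kappa>" "0 < \<delta>" "ball x0 \<epsilon> \<subseteq> U"
    "\<forall>a\<in>ball x0 \<epsilon>. \<forall>b\<in>ball x0 \<epsilon>. \<forall>z\<in>closed_segment a b.
        norm (X b - X a - blinfun_apply (X' z) (b - a)) \<le> K * (norm (b - a))\<^sup>2"
    "\<forall>a\<in>ball x0 \<epsilon>. \<forall>b\<in>ball x0 \<epsilon>. \<kappa> * norm (b - a) \<le> norm (X b - X a)"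
    "M \<inter> ball p \<delta> \<subseteq> X ` ball x0 \<epsilon>" "X ` U \<subseteq> M"
proof -
  obtain U X X' X'' x0 where X: "C2_chart M U X X' X''" "x0 \<in> U" "X x0 = p"
    using assms unfolding C2_surface_def by (metis imageE)
  obtain \<epsilon> K \<kappa> where b: "0 < \<epsilon>" "0 < K" "0 < \<kappa>" "ball x0 \<epsilon> \<subseteq> U"
    "\<And>a b z. a \<in> ball x0 \<epsilon> \<Longrightarrow> b \<in> ball x0 \<epsilon> \<Longrightarrow> z \<in> closed_segment a b \<Longrightarrow>
        norm (X b - X a - X' z (b - a)) \<le> K * (norm (b - a))\<^sup>2"
    "\<And>a b. a \<in> ball x0 \<epsilon> \<Longrightarrow> b \<in> ball x0 \<epsilon> \<Longrightarrow> \<kappa> * norm (b - a) \<le> norm (X b - X a)"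
    using C2_chart_local_bounds[OF X(1,2)] by metis
  have "openin (top_of_set M) (X ` ball x0 \<epsilon>)" using C2_chart_open_image[OF X(1) b(4)] by simp
  moreover have "p \<in> X ` ball x0 \<epsilon>" using X(3) b(1) by force
  ultimately obtain \<delta> where "0 < \<delta>" "ball p \<delta> \<inter> M \<subseteq> X ` ball x0 \<epsilon>"
    by (meson openin_contains_ball)
  moreover have "X ` U \<subseteq> M" using X(1) unfolding C2_chart_def by (meson openin_imp_subset)
  ultimately show thesis using b(5,6) by (intro that[OF X b(1-3) _ b(4)]) (auto simp: Int_commute)
qed

text \<open>The image of a parameter segment has speed differing from its chord by a quantity of second order, since the derivative of
  the chart varies by at most \<open>K\<close> times the length of the segment. Its length therefore exceeds the chord by at most a multiple
  of the square of the chord. All later information about shortest arcs comes from this comparison of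
  the intrinsic with the ambient distance.\<close>

lemma geodist_le_chord_locally:
  assumes "C2_surface M" "p \<in> M"
  obtains \<delta> C where "0 < \<delta>" "0 \<le> C"
    "\<And>x y. x \<in> M \<inter> ball p \<delta> \<Longrightarrow> y \<in> M \<inter> ball p \<delta> \<Longrightarrow>
      geodist M x y \<le> ennreal (norm (y - x) + C * (norm (y - x))\<^sup>2)"
proof -
  obtain U X X' X'' x0 \<epsilon> K \<kappa> \<delta> where X: "C2_chart M U X X' X''" and "x0 \<in> U" "X x0 = p"
    and pos: "0 < \<epsilon>" "0 < K" "0 < \<kappa>" "0 < \<delta>" and sub: "ball x0 \<epsilon> \<subseteq> U"
    and quad: "\<forall>a\<in>ball x0 \<epsilon>. \<forall>b\<in>ball x0 \<epsilon>. \<forall>z\<in>closed_segment a b.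
        norm (X b - X a - blinfun_apply (X' z) (b - a)) \<le> K * (norm (b - a))\<^sup>2"
    and below: "\<forall>a\<in>ball x0 \<epsilon>. \<forall>b\<in>ball x0 \<epsilon>. \<kappa> * norm (b - a) \<le> norm (X b - X a)"
    and \<delta>: "M \<inter> ball p \<delta> \<subseteq> X ` ball x0 \<epsilon>" and XM: "X ` U \<subseteq> M"
    by (rule C2_surface_chart_ball[OF assms]) (rule that; assumption)
  note quad = quad[rule_format] and below = below[rule_format]
  show thesis
  proof (rule that[of \<delta> "K / \<kappa>\<^sup>2"])
    fix x y assume "x \<in> M \<inter> ball p \<delta>" "y \<in> M \<inter> ball p \<delta>"
    then obtain a b where ab: "a \<in> ball x0 \<epsilon>" "b \<in> ball x0 \<epsilon>" "x = X a" "y = X b" using \<delta> by blast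
    let ?l = "linepath a b"
    define L where "L = norm (y - x) + K * (norm (b - a))\<^sup>2"
    have seg: "closed_segment a b \<subseteq> U" using ab sub closed_segment_subset convex_ball by blast
    have dX: "(X has_derivative X' z) (at z)" if "z \<in> U" for z
      using X that unfolding C2_chart_def by blast
    have dXl: "((X \<circ> ?l) has_derivative (\<lambda>h. X' (?l t) (h *\<^sub>R (b - a)))) (at t within {0..1})"
      if t: "t \<in> {0..1}" for t
    proof -
      have "?l t \<in> U" using seg t linepath_in_path by blast
      moreover have "(?l has_derivative (\<lambda>h. h *\<^sub>R (b - a))) (at t within {0..1})"
        using has_vector_derivative_linepath_within[of a b t "{0..1}"] by (simp add: has_vector_derivative_def)
      ultimately show ?thesis
        using has_derivative_compose[OF _ dX] unfolding o_def by blast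
    qed
    have speed: "onorm (\<lambda>h. X' (?l t) (h *\<^sub>R (b - a))) \<le> L" if t: "t \<in> {0..1}" for t
    proof (rule onorm_le)
      fix h :: real
      have "norm (X' (?l t) (b - a)) \<le> norm (X b - X a) + norm (X b - X a - X' (?l t) (b - a))"
        using norm_triangle_ineq4[of "X b - X a" "X b - X a - X' (?l t) (b - a)"] by simp
      also have "\<dots> \<le> L"
        unfolding L_def ab using quad[OF ab(1,2), of "?l t"] t linepath_in_path by (intro add_left_mono) blast
      finally show "norm (X' (?l t) (h *\<^sub>R (b - a))) \<le> L * norm h"
        by (simp add: blinfun.scaleR_right mult.commute[of L] mult_left_mono)
    qed
    have lip: "dist ((X \<circ> ?l) s) ((X \<circ> ?l) t) \<le> L * (t - s)" if "0 \<le> s" "s \<le> t" "t \<le> 1" for s t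
      using differentiable_bound[of "{0..1}" "X \<circ> ?l", OF _ dXl speed, of s t] that by (auto simp: dist_norm)
    have "continuous_on {0..1} (X \<circ> ?l)"
      using dXl has_derivative_continuous continuous_on_eq_continuous_within by blast
    then have "path (X \<circ> ?l)" by (simp add: path_def)
    moreover have "path_image (X \<circ> ?l) \<subseteq> M" using seg XM by (auto simp: path_image_compose)
    ultimately have "geodist M x y \<le> curve_length (X \<circ> ?l)"
      unfolding geodist_def using ab by (intro INF_lower) (auto simp: pathstart_compose pathfinish_compose)
    also have "\<dots> \<le> ennreal L" using lip pos by (intro curve_length_Lipschitz) (auto simp: L_def)
    also have "\<dots> \<le> ennreal (norm (y - x) + K / \<kappa>\<^sup>2 * (norm (y - x))\<^sup>2)"
    proof -
      have "(\<kappa> * norm (b - a))\<^sup>2 \<le> (norm (y - x))\<^sup>2"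
        using below[OF ab(1,2)] ab(3,4) pos by (intro power_mono) auto
      then have "(norm (b - a))\<^sup>2 \<le> (norm (y - x))\<^sup>2 / \<kappa>\<^sup>2"
        using pos by (simp add: pos_le_divide_eq power_mult_distrib mult.commute)
      then have "K * (norm (b - a))\<^sup>2 \<le> K * ((norm (y - x))\<^sup>2 / \<kappa>\<^sup>2)" using pos by (intro mult_left_mono) auto
      then show ?thesis unfolding L_def by (intro ennreal_leI) simp
    qed
    finally show "geodist M x y \<le> ennreal (norm (y - x) + K / \<kappa>\<^sup>2 * (norm (y - x))\<^sup>2)" .
  qed (use pos in auto)
qed

lemma one_sided_velocity_iff:
  fixes c :: "real \<Rightarrow> 'a::real_normed_vector"
  shows "(c has_vector_derivative v) (at 0 within {0..e}) \<longleftrightarrow>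
    ((\<lambda>t. (c t - c 0) /\<^sub>R t) \<longlongrightarrow> v) (at 0 within {0..e})"
proof -
  have "(c has_vector_derivative v) (at 0 within {0..e}) \<longleftrightarrow>
      ((\<lambda>t. (1 / norm t) *\<^sub>R (c t - (c 0 + t *\<^sub>R v))) \<longlongrightarrow> 0) (at 0 within {0..e})"
    unfolding has_vector_derivative_def has_derivative_within by (simp add: bounded_linear_scaleR_left)
  also have "\<dots> \<longleftrightarrow> ((\<lambda>t. (c t - c 0) /\<^sub>R t - v) \<longlongrightarrow> 0) (at 0 within {0..e})"
    by (intro filterlim_cong refl)
       (auto simp: eventually_at_filter algebra_simps divide_inverse intro!: always_eventually)
  finally show ?thesis by (simp add: LIM_zero_iff)
qed

text \<open>The tangent plane is a two-dimensional linear space: it is the range of the derivative of a chart. A curve on the surface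
  lifts to parameters at a distance comparable to the one in space, so its difference quotients are within a vanishing
  distance of the range, which is closed. The argument applies to curves starting at \<open>p\<close>, for which
  only a one-sided derivative is available; shortest arcs are of this kind.\<close>

lemma tangent_plane_eq_range:
  assumes "C2_surface M" "p \<in> M"
  obtains f :: "real^2 \<Rightarrow> real^3" where "linear f" "inj f" "tangent_plane M p = range f"
    "\<And>c e v. 0 < e \<Longrightarrow> c ` {0..e} \<subseteq> M \<Longrightarrow> c 0 = p \<Longrightarrow>
        (c has_vector_derivative v) (at 0 within {0..e}) \<Longrightarrow> v \<in> range f"
proof -
  obtain U X X' X'' x0 \<epsilon> K \<kappa> \<delta> where X: "C2_chart M U X X' X''" "x0 \<in> U" "X x0 = p"
    and pos: "0 < \<epsilon>" "0 < K" "0 < \<kappa>" "0 < \<delta>" and sub: "ball x0 \<epsilon> \<subseteq> U"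
    and quad: "\<forall>a\<in>ball x0 \<epsilon>. \<forall>b\<in>ball x0 \<epsilon>. \<forall>z\<in>closed_segment a b.
        norm (X b - X a - blinfun_apply (X' z) (b - a)) \<le> K * (norm (b - a))\<^sup>2"
    and below: "\<forall>a\<in>ball x0 \<epsilon>. \<forall>b\<in>ball x0 \<epsilon>. \<kappa> * norm (b - a) \<le> norm (X b - X a)"
    and \<delta>: "M \<inter> ball p \<delta> \<subseteq> X ` ball x0 \<epsilon>" and XM: "X ` U \<subseteq> M"
    by (rule C2_surface_chart_ball[OF assms]) (rule that; assumption)
  note quad = quad[rule_format] and below = below[rule_format]
  let ?f = "blinfun_apply (X' x0)"
  have lin: "linear ?f" by (simp add: blinfun.bounded_linear_right bounded_linear.linear)
  have inj: "inj ?f" and dX: "(X has_derivative ?f) (at x0)" using X unfolding C2_chart_def by auto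
  have one_sided: "v \<in> range ?f"
    if e: "0 < e" and cM: "c ` {0..e} \<subseteq> M" and c0: "c 0 = p"
      and dc: "(c has_vector_derivative v) (at 0 within {0..e})" for c e v
  proof -
    have q: "((\<lambda>t. (c t - p) /\<^sub>R t) \<longlongrightarrow> v) (at 0 within {0..e})"
      using dc c0 one_sided_velocity_iff by blast
    have cl: "((\<lambda>t. c t - p) \<longlongrightarrow> 0) (at 0 within {0..e})"
      using has_vector_derivative_continuous[OF dc] c0 by (simp add: continuous_within LIM_zero_iff)
    then have near: "\<forall>\<^sub>F t in at 0 within {0..e}. norm (c t - p) < \<delta>"
      using pos(4) tendstoD[OF cl, of \<delta>] by simp
    \<comment> \<open>a lift of the curve to parameters; the lower bound for the chart keeps it close to \<open>x0\<close>\<close>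
    define a where "a t = (SOME a. a \<in> ball x0 \<epsilon> \<and> X a = c t)" for t
    have a: "a t \<in> ball x0 \<epsilon>" "X (a t) = c t" if "norm (c t - p) < \<delta>" "t \<in> {0..e}" for t
    proof -
      have "c t \<in> M" using that(2) cM by blast
      moreover have "c t \<in> ball p \<delta>" using that(1) by (simp add: dist_norm norm_minus_commute)
      ultimately have "c t \<in> M \<inter> ball p \<delta>" by blast
      then have "c t \<in> X ` ball x0 \<epsilon>" by (rule subsetD[OF \<delta>])
      then have "\<exists>a. a \<in> ball x0 \<epsilon> \<and> X a = c t" by (metis imageE)
      from someI_ex[OF this] show "a t \<in> ball x0 \<epsilon>" "X (a t) = c t"
        unfolding a_def by (rule conjunct1, rule conjunct2)
    qed
    define r where "r t = ?f ((a t - x0) /\<^sub>R t)" for t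
    have err: "norm ((c t - p) /\<^sub>R t - r t) \<le> K / \<kappa>\<^sup>2 * (norm ((c t - p) /\<^sub>R t) * norm (c t - p))"
      if near: "norm (c t - p) < \<delta>" and t: "t \<in> {0..e}" "t \<noteq> 0" for t
    proof -
      have x0b: "x0 \<in> ball x0 \<epsilon>" using pos by simp
      have t0: "0 < t" using t by simp
      have "(\<kappa> * norm (a t - x0))\<^sup>2 \<le> (norm (c t - p))\<^sup>2"
        using below[OF x0b a(1)[OF near t(1)]] a(2)[OF near t(1)] X(3) pos by (intro power_mono) auto
      then have 1: "(norm (a t - x0))\<^sup>2 \<le> (norm (c t - p))\<^sup>2 / \<kappa>\<^sup>2"
        using pos by (simp add: pos_le_divide_eq power_mult_distrib mult.commute)
      have "(c t - p) /\<^sub>R t - r t = (X (a t) - X x0 - ?f (a t - x0)) /\<^sub>R t"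
        using a(2)[OF near t(1)] X(3) by (simp add: r_def blinfun.scaleR_right flip: scaleR_diff_right)
      then have "norm ((c t - p) /\<^sub>R t - r t) = norm (X (a t) - X x0 - ?f (a t - x0)) / t"
        using t0 by (simp add: divide_inverse mult.commute)
      also have "\<dots> \<le> K * (norm (a t - x0))\<^sup>2 / t"
        using quad[OF x0b a(1)[OF near t(1)], of x0] t0 by (intro divide_right_mono) auto
      also have "\<dots> \<le> K * ((norm (c t - p))\<^sup>2 / \<kappa>\<^sup>2) / t"
        using 1 pos t0 by (intro divide_right_mono mult_left_mono) auto
      also have "\<dots> = K / \<kappa>\<^sup>2 * (norm ((c t - p) /\<^sub>R t) * norm (c t - p))"
        using t0 by (simp add: divide_inverse power2_eq_square)
      finally show ?thesis .
    qed
    have "((\<lambda>t. K / \<kappa>\<^sup>2 * (norm ((c t - p) /\<^sub>R t) * norm (c t - p))) \<longlongrightarrow> K / \<kappa>\<^sup>2 * (norm v * norm (0::real^3))) (at 0 within {0..e})"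
      by (intro tendsto_intros q cl)
    then have bound_lim: "((\<lambda>t. K / \<kappa>\<^sup>2 * (norm ((c t - p) /\<^sub>R t) * norm (c t - p))) \<longlongrightarrow> 0) (at 0 within {0..e})"
      by (simp only: norm_zero mult_zero_right)
    have "\<forall>\<^sub>F t in at 0 within {0..e}. norm ((c t - p) /\<^sub>R t - r t)
        \<le> K / \<kappa>\<^sup>2 * (norm ((c t - p) /\<^sub>R t) * norm (c t - p))"
      using near unfolding eventually_at_filter by eventually_elim (blast intro: err)
    from tendsto_diff[OF q Lim_null_comparison[OF this bound_lim]]
    have "(r \<longlongrightarrow> v) (at 0 within {0..e})"
      by (simp only: diff_diff_eq2 add_diff_cancel_left' diff_zero)
    moreover have "closed (range ?f)"
      using lin by (intro closed_subspace linear_subspace_image) auto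
    moreover have "at 0 within {0..e} \<noteq> bot"
      using e by (simp add: trivial_limit_within islimpt_greaterThanLessThan1 islimpt_Icc)
    ultimately show ?thesis
      by (intro Lim_in_closed_set[of "range ?f" r]) (auto simp: r_def)
  qed
  have "tangent_plane M p \<subseteq> range ?f"
  proof
    fix v assume "v \<in> tangent_plane M p"
    then obtain c e where c: "0 < e" "c ` {-e<..<e} \<subseteq> M" "c 0 = p" "(c has_vector_derivative v) (at 0)"
      unfolding tangent_plane_def by blast
    have "{0..e/2} \<subseteq> {-e<..<e}" using c(1) by auto
    then show "v \<in> range ?f"
      using c by (intro one_sided[of "e/2" c]) (auto intro: has_vector_derivative_at_within)
  qed
  moreover have "?f \<xi> \<in> tangent_plane M p" for \<xi>
  proof -
    define e where "e = \<epsilon> / (norm \<xi> + 1)"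
    have e: "0 < e" using pos by (simp add: e_def add_nonneg_pos)
    have "x0 + t *\<^sub>R \<xi> \<in> ball x0 \<epsilon>" if "t \<in> {-e<..<e}" for t
    proof -
      have "\<bar>t\<bar> * norm \<xi> \<le> \<bar>t\<bar> * (norm \<xi> + 1)" by (intro mult_left_mono) auto
      also have "\<dots> < e * (norm \<xi> + 1)" using that by (intro mult_strict_right_mono) (auto simp: add_nonneg_pos)
      also have "\<dots> = \<epsilon>" using add_nonneg_pos[of "norm \<xi>" 1] by (simp add: e_def)
      finally show ?thesis by (simp add: dist_norm)
    qed
    then have "(\<lambda>t. X (x0 + t *\<^sub>R \<xi>)) ` {-e<..<e} \<subseteq> M" using sub XM by blast
    moreover have "((\<lambda>t. X (x0 + t *\<^sub>R \<xi>)) has_vector_derivative ?f \<xi>) (at 0)"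
    proof -
      have "((\<lambda>t. x0 + t *\<^sub>R \<xi>) has_derivative (\<lambda>h. h *\<^sub>R \<xi>)) (at 0)"
        by (auto intro!: derivative_eq_intros)
      from has_derivative_compose[OF this, of X ?f] dX show ?thesis
        by (simp add: has_vector_derivative_def blinfun.scaleR_right)
    qed
    ultimately show ?thesis using e X(3) unfolding tangent_plane_def
      by (intro CollectI exI[of _ "\<lambda>t. X (x0 + t *\<^sub>R \<xi>)"] exI[of _ e]) auto
  qed
  ultimately have eq: "tangent_plane M p = range ?f" by blast
  show thesis by (rule that[OF lin inj eq one_sided])
qed

text \<open>Invariance of domain, transported from the plane to the surface by charts.\<close>

lemma openin_inj_image_surface:
  fixes E :: "real^2 \<Rightarrow> real^3"
  assumes M: "C2_surface M" and V: "open V" and cont: "continuous_on V E" and inj: "inj_on E V"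
    and EM: "E ` V \<subseteq> M"
  shows "openin (top_of_set M) (E ` V)"
proof (subst openin_subopen, clarify)
  fix v assume v: "v \<in> V"
  then have "E v \<in> M" using EM by blast
  then obtain U X X' X'' where X: "C2_chart M U X X' X''" "E v \<in> X ` U"
    using M unfolding C2_surface_def by blast
  then obtain Y where Y: "homeomorphism U (X ` U) X Y" and o: "openin (top_of_set M) (X ` U)"
    unfolding C2_chart_def by blast
  obtain T where T: "open T" "X ` U = M \<inter> T" using o by (auto simp: openin_open)
  define W where "W = V \<inter> E -` T"
  have W: "open W" unfolding W_def using cont V T(1) by (rule continuous_open_preimage)
  have EW: "E ` W \<subseteq> X ` U" using T(2) EM by (auto simp: W_def)
  have contYE: "continuous_on W (Y \<circ> E)"
  proof (rule continuous_on_compose)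
    show "continuous_on W E" using cont by (rule continuous_on_subset) (auto simp: W_def)
    show "continuous_on (E ` W) Y" by (rule continuous_on_subset[OF homeomorphism_cont2[OF Y] EW])
  qed
  have XY: "X (Y (E w)) = E w" "Y (E w) \<in> U" if "w \<in> W" for w
  proof -
    have "E w \<in> X ` U" using EW that by (rule subsetD[OF _ imageI])
    then show "X (Y (E w)) = E w" "Y (E w) \<in> U"
      using homeomorphism_apply2[OF Y] homeomorphism_image2[OF Y] imageI by metis+
  qed
  have "inj_on (Y \<circ> E) W"
  proof (rule inj_onI)
    fix w w' assume "w \<in> W" "w' \<in> W" "(Y \<circ> E) w = (Y \<circ> E) w'"
    then have "E w = E w'" using XY(1) by (metis comp_apply)
    then show "w = w'" using inj \<open>w \<in> W\<close> \<open>w' \<in> W\<close> by (auto simp: W_def inj_on_def)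
  qed
  then have "open ((Y \<circ> E) ` W)" using invariance_of_domain[OF contYE W] by blast
  then have "openin (top_of_set M) (X ` (Y \<circ> E) ` W)"
    using XY(2) by (intro C2_chart_open_image[OF X(1)]) auto
  also have "X ` (Y \<circ> E) ` W = E ` W" using XY(1) by (force simp: image_image)
  finally have "openin (top_of_set M) (E ` W)" .
  moreover have "v \<in> W" using v X(2) T(2) by (auto simp: W_def)
  ultimately show "\<exists>T. openin (top_of_set M) T \<and> E v \<in> T \<and> T \<subseteq> E ` V"
    by (intro exI[of _ "E ` W"]) (auto simp: W_def)
qed

section \<open>Initial directions of shortest arcs\<close>

lemma velocity_iff_at_right:
  fixes c :: "real \<Rightarrow> 'a::real_normed_vector"
  assumes "0 < e"
  shows "(c has_vector_derivative v) (at 0 within {0..e}) \<longleftrightarrow>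
    ((\<lambda>t. (c t - c 0) /\<^sub>R t) \<longlongrightarrow> v) (at_right 0)"
  using one_sided_velocity_iff[of c v e] by (simp only: at_within_Icc_at_right[OF assms])

text \<open>If a curve is parametrized by arc length up to an error of second order, then for \<open>t / 2 \<le> s \<le> t\<close> the three points at
  parameters \<open>0\<close>, \<open>s\<close>, \<open>t\<close> form a triangle that is nearly degenerate, and the difference quotients \<open>q s\<close> and \<open>q t\<close> differ by
  at most a multiple of \<open>sqrt t\<close>. Along the halvings of \<open>t\<close> these bounds form a geometric series, so the quotients
  satisfy the Cauchy condition at \<open>0\<close>.\<close>

lemma has_initial_direction:
  fixes g :: "real \<Rightarrow> 'a::{real_inner, banach}"
  assumes e: "0 < e" and C: "0 \<le> C"
    and upper: "\<And>s t. 0 \<le> s \<Longrightarrow> s \<le> t \<Longrightarrow> t \<le> e \<Longrightarrow> norm (g t - g s) \<le> t - s"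
    and lower: "\<And>s t. 0 \<le> s \<Longrightarrow> s \<le> t \<Longrightarrow> t \<le> e \<Longrightarrow> t - s - C * (t - s)\<^sup>2 \<le> norm (g t - g s)"
  obtains u where "norm u = 1" "((\<lambda>t. (g t - g 0) /\<^sub>R t) \<longlongrightarrow> u) (at_right 0)"
proof -
  define q where "q t = (g t - g 0) /\<^sub>R t" for t
  \<comment> \<open>below \<open>e1\<close> the defect \<open>C * t\<^sup>2\<close> is at most \<open>t / 2\<close>, hence at most \<open>s\<close>\<close>
  define e1 where "e1 = min e (1 / (2 * (C + 1)))"
  have e1: "0 < e1" "e1 \<le> e" using e C by (auto simp: e1_def)
  have Ce1: "C * t \<le> 1/2" if "0 \<le> t" "t \<le> e1" for t
  proof -
    have "C * t \<le> (C + 1) * (1 / (2 * (C + 1)))"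
      using that C by (intro mult_mono) (auto simp: e1_def)
    also have "\<dots> = 1/2" using C by (simp add: field_simps)
    finally show ?thesis .
  qed
  define D where "D = sqrt (8 * C)"
  have D: "0 \<le> D" using C by (simp add: D_def)
  have near: "norm (q s - q t) \<le> D * sqrt t" if t: "0 < t" "t \<le> e1" and s: "t / 2 \<le> s" "s \<le> t" for s t
  proof -
    define y z where "y = g s - g 0" and "z = g t - g 0"
    have s0: "0 < s" using s t by linarith
    have Ct: "C * t\<^sup>2 \<le> t / 2"
      using mult_right_mono[OF Ce1[of t], of t] t by (simp add: power2_eq_square mult.assoc)
    have y: "norm y \<le> s" unfolding y_def using upper[of 0 s] s0 s t e1 by simp
    have z: "norm z \<le> t" "t - C * t\<^sup>2 \<le> norm z"
      unfolding z_def using upper[of 0 t] lower[of 0 t] t e1 by simp_all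
    have zy: "norm (z - y) \<le> t - s" unfolding y_def z_def using upper[of s t] s0 s t e1 by simp
    have "s * t - 2 * C * t ^ 3 \<le> (t - C * t\<^sup>2) * (s - C * t\<^sup>2)"
    proof -
      have "C * t\<^sup>2 * s \<le> C * t\<^sup>2 * t" using C s by (intro mult_left_mono) auto
      moreover have "0 \<le> (C * t\<^sup>2) * (C * t\<^sup>2)" using C by simp
      ultimately show ?thesis by (simp add: algebra_simps power2_eq_square power3_eq_cube)
    qed
    also have "\<dots> \<le> norm z * (norm z - (t - s))"
      using z Ct s t by (intro mult_mono) auto
    also have "\<dots> \<le> norm z * (norm z - norm (z - y))"
      using zy by (intro mult_left_mono) auto
    also have "\<dots> \<le> z \<bullet> z - (z - y) \<bullet> z"
      using norm_cauchy_schwarz[of "z - y" z] by (simp add: algebra_simps dot_square_norm power2_eq_square)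
    also have "\<dots> = y \<bullet> z" by (simp add: inner_diff_left)
    finally have yz: "s * t - 2 * C * t ^ 3 \<le> y \<bullet> z" .
    have "(norm (q s - q t))\<^sup>2 = (norm y)\<^sup>2 / s\<^sup>2 + (norm z)\<^sup>2 / t\<^sup>2 - 2 * (y \<bullet> z) / (s * t)"
      using s0 t unfolding q_def y_def[symmetric] z_def[symmetric]
      by (simp only: power2_norm_eq_inner)
         (simp add: inner_diff_left inner_diff_right inner_commute[of z y] field_simps power2_eq_square)
    also have "\<dots> \<le> 1 + 1 - 2 * (s * t - 2 * C * t ^ 3) / (s * t)"
      using y z(1) yz s0 t
      by (intro diff_mono add_mono divide_right_mono) (auto intro!: power_mono simp: divide_le_eq_1)
    also have "\<dots> = 4 * C * t\<^sup>2 / s" using s0 t by (simp add: field_simps power2_eq_square power3_eq_cube)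
    also have "\<dots> \<le> 4 * C * t\<^sup>2 / (t / 2)" using s t C by (intro divide_left_mono) auto
    also have "\<dots> = 8 * C * t" using t by (simp add: power2_eq_square)
    finally have "norm (q s - q t) \<le> sqrt (8 * C * t)" by (rule real_le_rsqrt)
    then show ?thesis by (simp add: D_def real_sqrt_mult)
  qed
  have far: "norm (q s - q t) \<le> 4 * D * sqrt t" if "0 < s" "s \<le> t" "t \<le> e1" "t \<le> 2 ^ n * s" for s t n
    using that
  proof (induction n arbitrary: t)
    case 0
    then show ?case using D by simp
  next
    case (Suc n)
    show ?case
    proof (cases "t / 2 \<le> s")
      case True
      then have "norm (q s - q t) \<le> D * sqrt t" using Suc.prems by (intro near) auto
      also have "\<dots> \<le> 4 * D * sqrt t" using D Suc.prems by (intro mult_right_mono) auto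
      finally show ?thesis .
    next
      case False
      \<comment> \<open>the constant 4 reproduces itself because \<open>4 * (3/4) + 1 = 4\<close>\<close>
      have "sqrt (t / 2) \<le> sqrt ((3/4)\<^sup>2 * t)"
        using Suc.prems by (intro real_sqrt_le_mono) (simp add: power2_eq_square)
      then have sq: "sqrt (t / 2) \<le> 3/4 * sqrt t" by (simp add: real_sqrt_mult)
      have "norm (q s - q (t / 2)) \<le> 4 * D * sqrt (t / 2)"
        using Suc.prems False by (intro Suc.IH) auto
      also have "\<dots> \<le> 4 * D * (3/4 * sqrt t)" using sq D by (intro mult_left_mono) auto
      finally have "norm (q s - q (t / 2)) \<le> 3 * D * sqrt t" by simp
      moreover have "norm (q (t / 2) - q t) \<le> D * sqrt t" using Suc.prems by (intro near) auto
      moreover have "norm (q s - q t) \<le> norm (q s - q (t / 2)) + norm (q (t / 2) - q t)"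
        using norm_triangle_ineq[of "q s - q (t / 2)" "q (t / 2) - q t"] by simp
      ultimately show ?thesis by (simp add: algebra_simps)
    qed
  qed
  have cauchy: "norm (q s - q t) \<le> 4 * D * sqrt t" if st: "0 < s" "s \<le> t" "t \<le> e1" for s t
  proof -
    obtain n where "t / s < 2 ^ n" using real_arch_pow[of 2 "t / s"] by auto
    then show ?thesis using st by (intro far[of _ _ n]) (auto simp: divide_less_eq split: if_splits)
  qed
  define \<tau> where "\<tau> n = e1 / real (Suc n)" for n
  have \<tau>: "0 < \<tau> n" "\<tau> n \<le> e1" for n
    using e1 by (simp_all add: \<tau>_def pos_divide_le_eq)
  have \<tau>_mono: "\<tau> n \<le> \<tau> m" if "m \<le> n" for m n
    unfolding \<tau>_def using e1 that by (intro divide_left_mono) auto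
  have \<tau>0: "\<tau> \<longlonglongrightarrow> 0"
    unfolding \<tau>_def using LIMSEQ_Suc[OF lim_const_over_n[of e1]] by simp
  have sq0: "(\<lambda>n. 4 * D * sqrt (\<tau> n)) \<longlonglongrightarrow> 0"
    using tendsto_mult_right_zero[OF tendsto_real_sqrt[OF \<tau>0, simplified], of "4 * D"] .
  have "Cauchy (\<lambda>n. q (\<tau> n))"
  proof (rule metric_CauchyI)
    fix \<epsilon> :: real assume "0 < \<epsilon>"
    then obtain N where N: "4 * D * sqrt (\<tau> N) < \<epsilon> / 2"
      using order_tendstoD(2)[OF sq0, of "\<epsilon> / 2"] by (auto simp: eventually_sequentially)
    have "dist (q (\<tau> n)) (q (\<tau> N)) < \<epsilon> / 2" if "N \<le> n" for n
      using cauchy[of "\<tau> n" "\<tau> N"] \<tau> \<tau>_mono[OF that] N by (simp add: dist_norm)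
    then have "\<forall>m\<ge>N. \<forall>n\<ge>N. dist (q (\<tau> m)) (q (\<tau> n)) < \<epsilon>"
      by (metis dist_triangle_half_l dist_commute)
    then show "\<exists>N. \<forall>m\<ge>N. \<forall>n\<ge>N. dist (q (\<tau> m)) (q (\<tau> n)) < \<epsilon>" by blast
  qed
  then obtain u where u: "(\<lambda>n. q (\<tau> n)) \<longlonglongrightarrow> u"
    by (auto simp: Cauchy_convergent_iff convergent_def)
  have bound: "norm (q t - u) \<le> 4 * D * sqrt t" if t: "0 < t" "t \<le> e1" for t
  proof (rule tendsto_upperbound)
    show "(\<lambda>n. norm (q t - q (\<tau> n))) \<longlonglongrightarrow> norm (q t - u)" by (intro tendsto_intros u)
    show "\<forall>\<^sub>F n in sequentially. norm (q t - q (\<tau> n)) \<le> 4 * D * sqrt t"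
      using order_tendstoD(2)[OF \<tau>0 t(1)]
      by eventually_elim (metis cauchy \<tau>(1) less_imp_le norm_minus_commute t(2))
  qed simp
  have in_range: "\<forall>\<^sub>F t in at_right 0. 0 < t \<and> t \<le> e1"
    unfolding eventually_at_right_field using e1 by (intro exI[of _ e1]) auto
  have sqrt0: "((\<lambda>t. 4 * D * sqrt t) \<longlongrightarrow> 0) (at_right 0)"
    by (rule tendsto_eq_intros refl | simp)+
  have "((\<lambda>t. q t - u) \<longlongrightarrow> 0) (at_right 0)"
    by (rule Lim_null_comparison[OF eventually_mono[OF in_range] sqrt0]) (use bound in blast)
  then have q: "(q \<longlongrightarrow> u) (at_right 0)" by (simp add: LIM_zero_iff)
  have lim: "((\<lambda>t. norm (q t)) \<longlongrightarrow> 1) (at_right 0)"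
  proof (rule tendsto_sandwich)
    have "1 - C * t \<le> norm (q t) \<and> norm (q t) \<le> 1" if t: "0 < t" "t \<le> e1" for t
    proof -
      have "t - C * t\<^sup>2 \<le> norm (g t - g 0)" "norm (g t - g 0) \<le> t"
        using upper[of 0 t] lower[of 0 t] t e1 by simp_all
      then have "(1 - C * t) * t \<le> norm (g t - g 0)" "norm (g t - g 0) \<le> 1 * t"
        by (simp_all add: algebra_simps power2_eq_square)
      moreover have "norm (q t) = norm (g t - g 0) / t" using t by (simp add: q_def divide_inverse mult.commute)
      ultimately show ?thesis using t by (simp only: pos_le_divide_eq pos_divide_le_eq)
    qed
    then show "\<forall>\<^sub>F t in at_right 0. 1 - C * t \<le> norm (q t)" "\<forall>\<^sub>F t in at_right 0. norm (q t) \<le> 1"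
      using in_range by (auto elim: eventually_mono)
    show "((\<lambda>t. 1 - C * t) \<longlongrightarrow> 1) (at_right 0)" by (rule tendsto_eq_intros refl | simp)+
  qed simp
  have "norm u = 1" using tendsto_unique[OF _ tendsto_norm[OF q] lim] by simp
  with q show thesis unfolding q_def by (rule that[rotated])
qed

lemma shortest_arc_dist_le:
  assumes "shortest_arc M g l p q" "s \<in> {0..l}" "t \<in> {0..l}"
  shows "norm (g t - g s) \<le> \<bar>t - s\<bar>"
proof -
  have "ennreal (dist (g s) (g t)) \<le> ennreal \<bar>s - t\<bar>"
    using assms dist_le_geodist[of "g s" "g t" M] unfolding shortest_arc_def by simp
  then show ?thesis by (simp add: dist_norm norm_minus_commute)
qed

text \<open>On a shortest arc the intrinsic distance is the difference of the parameters, and the intrinsic distance exceeds the chord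
  only by a term of second order.\<close>

lemma shortest_arc_initial_direction:
  assumes M: "C2_surface M" "p \<in> M" and g: "shortest_arc M g l p q" and l: "0 < l"
  obtains u where "norm u = 1" "(g has_vector_derivative u) (at 0 within {0..l})"
    "u \<in> tangent_plane M p"
proof -
  obtain \<delta> C where \<delta>: "0 < \<delta>" "0 \<le> C" and
    le: "\<And>x y. x \<in> M \<inter> ball p \<delta> \<Longrightarrow> y \<in> M \<inter> ball p \<delta> \<Longrightarrow>
      geodist M x y \<le> ennreal (norm (y - x) + C * (norm (y - x))\<^sup>2)"
    using geodist_le_chord_locally[OF M] by metis
  define e where "e = min l (\<delta> / 2)"
  have e: "0 < e" "e \<le> l" "e < \<delta>" using l \<delta> by (auto simp: e_def)
  have g0: "g 0 = p" and gM: "g ` {0..l} \<subseteq> M" using g unfolding shortest_arc_def by auto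
  have upper: "norm (g t - g s) \<le> t - s" if "0 \<le> s" "s \<le> t" "t \<le> e" for s t
    using shortest_arc_dist_le[OF g, of s t] that e by auto
  have mem: "g t \<in> M \<inter> ball p \<delta>" if t: "0 \<le> t" "t \<le> e" for t
  proof -
    have "norm (g t - p) < \<delta>" using upper[of 0 t] t g0 e by simp
    then have "g t \<in> ball p \<delta>" by (simp add: dist_norm norm_minus_commute)
    moreover have "g t \<in> M" using gM t e by (simp add: image_subset_iff)
    ultimately show ?thesis by blast
  qed
  have lower: "t - s - C * (t - s)\<^sup>2 \<le> norm (g t - g s)" if st: "0 \<le> s" "s \<le> t" "t \<le> e" for s t
  proof -
    have "geodist M (g s) (g t) = ennreal (t - s)"
      using g st e unfolding shortest_arc_def by simp
    moreover have "geodist M (g s) (g t) \<le> ennreal (norm (g t - g s) + C * (norm (g t - g s))\<^sup>2)"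
      using st by (intro le mem) auto
    moreover have "0 \<le> norm (g t - g s) + C * (norm (g t - g s))\<^sup>2" using \<delta> by simp
    ultimately have "t - s \<le> norm (g t - g s) + C * (norm (g t - g s))\<^sup>2"
      by (simp only: ennreal_le_iff)
    also have "\<dots> \<le> norm (g t - g s) + C * (t - s)\<^sup>2"
      using upper[OF st] \<delta> by (intro add_left_mono mult_left_mono power_mono) auto
    finally show ?thesis by simp
  qed
  obtain u where u: "norm u = 1" "((\<lambda>t. (g t - g 0) /\<^sub>R t) \<longlongrightarrow> u) (at_right 0)"
    using has_initial_direction[OF e(1) \<delta>(2) upper lower] by blast
  have dg: "(g has_vector_derivative u) (at 0 within {0..l})"
    using u(2) velocity_iff_at_right[OF l] by blast
  obtain f :: "real^2 \<Rightarrow> real^3" where f: "tangent_plane M p = range f"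
    "\<And>c e v. 0 < e \<Longrightarrow> c ` {0..e} \<subseteq> M \<Longrightarrow> c 0 = p \<Longrightarrow>
        (c has_vector_derivative v) (at 0 within {0..e}) \<Longrightarrow> v \<in> range f"
    using tangent_plane_eq_range[OF M] by metis
  have "u \<in> tangent_plane M p" using f(2)[OF l gM g0 dg] f(1) by simp
  with u(1) dg show thesis by (rule that)
qed

lemma initial_direction_unique:
  assumes "(g has_vector_derivative u) (at 0 within {0..l})" "(g has_vector_derivative v) (at 0 within {0..l})"
    and "0 < l"
  shows "u = v"
  using assms(1,2) unfolding velocity_iff_at_right[OF assms(3)]
  by (rule tendsto_unique[OF trivial_limit_at_right_real])

lemma tangent_ray_pointE:
  assumes M: "C2_surface M" "p \<in> M" and r: "tangent_ray_point M p r w v" and w: "0 < w"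
  obtains g l u where "shortest_arc M g l p r" "0 < l" "norm u = 1"
    "(g has_vector_derivative u) (at 0 within {0..l})" "v = w *\<^sub>R u"
proof -
  obtain g l u t where g: "shortest_arc M g l p r" "0 < l" "(g has_vector_derivative u) (at 0 within {0..l})"
    and t: "0 \<le> t" "v = t *\<^sub>R u" and v: "norm v = w"
    using r unfolding tangent_ray_point_def by blast
  have "norm u = 1"
    using shortest_arc_initial_direction[OF M g(1,2)] initial_direction_unique[OF g(3) _ g(2)] by metis
  moreover have "t = w" using t v calculation by simp
  ultimately show thesis using that g t by blast
qed

section \<open>First variation and the balance of tangent vectors\<close>

text \<open>To reach \<open>r\<close> from \<open>c t\<close>, go straight to the point \<open>g (K * t)\<close> and follow the shortest arc from there. Up to
  higher order the first part has length \<open>t * norm (v - K *\<^sub>R u)\<close>, and for large \<open>K\<close> the difference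
  \<open>norm (v - K *\<^sub>R u) - K\<close> is close to \<open>- (u \<bullet> v)\<close>. This bounds the variation of the distance from above,
  which is the side that matters at a minimum.\<close>

lemma first_variation_le:
  assumes M: "C2_surface M" and g: "shortest_arc M g l p r" "0 < l"
    and u: "(g has_vector_derivative u) (at 0 within {0..l})" "norm u = 1"
    and c: "0 < e" "c ` {0..e} \<subseteq> M" "c 0 = p" "(c has_vector_derivative v) (at 0 within {0..e})"
    and \<epsilon>: "0 < \<epsilon>"
  shows "\<forall>\<^sub>F t in at_right 0. geodist M (c t) r \<le> ennreal (l + t * (\<epsilon> - u \<bullet> v)) \<and> 0 \<le> l + t * (\<epsilon> - u \<bullet> v)"
proof -
  have g0: "g 0 = p" and gl: "g l = r" and gM: "g ` {0..l} \<subseteq> M" using g unfolding shortest_arc_def by auto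
  have pM: "p \<in> M" using gM g0 g(2) by force
  obtain \<delta> C where \<delta>: "0 < \<delta>" "0 \<le> C" and
    le: "\<And>x y. x \<in> M \<inter> ball p \<delta> \<Longrightarrow> y \<in> M \<inter> ball p \<delta> \<Longrightarrow>
      geodist M x y \<le> ennreal (norm (y - x) + C * (norm (y - x))\<^sup>2)"
    using geodist_le_chord_locally[OF M pM] by metis
  \<comment> \<open>\<open>norm (v - K *\<^sub>R u)\<close> is at most \<open>K - u \<bullet> v + (norm v)\<^sup>2 / (2 * K)\<close>, so this \<open>K\<close> leaves an error below \<open>\<epsilon>\<close>\<close>
  define R where "R = (norm v)\<^sup>2 / \<epsilon>"
  define K where "K = norm v + R + 1"
  have K: "0 < K" "norm v \<le> K" "(norm v)\<^sup>2 / (2 * K) < \<epsilon>"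
  proof -
    have R: "0 \<le> R" using \<epsilon> by (simp add: R_def)
    then show "0 < K" "norm v \<le> K" by (auto simp: K_def add_nonneg_pos)
    have "R < 2 * K" using R norm_ge_zero[of v] unfolding K_def by argo
    then show "(norm v)\<^sup>2 / (2 * K) < \<epsilon>" using \<open>0 < K\<close> \<epsilon> by (simp add: R_def field_simps)
  qed
  have slope: "norm (v - K *\<^sub>R u) < K + (\<epsilon> - u \<bullet> v)"
  proof -
    define \<eta> where "\<eta> = (norm v)\<^sup>2 / (2 * K) - u \<bullet> v"
    have "u \<bullet> v \<le> K" using norm_cauchy_schwarz[of u v] u(2) K by simp
    moreover have "0 \<le> (norm v)\<^sup>2 / (2 * K)" using K(1) by simp
    ultimately have nn: "0 \<le> K + \<eta>" unfolding \<eta>_def by linarith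
    have "(norm (v - K *\<^sub>R u))\<^sup>2 = (norm v)\<^sup>2 - 2 * K * (u \<bullet> v) + K\<^sup>2 * (norm u)\<^sup>2"
      by (simp only: power2_norm_eq_inner)
         (simp add: inner_diff_left inner_diff_right inner_commute[of v u] algebra_simps power2_eq_square)
    also have "\<dots> = K\<^sup>2 + 2 * K * \<eta>"
      using u(2) K(1) by (simp add: \<eta>_def right_diff_distrib)
    also have "\<dots> \<le> (K + \<eta>)\<^sup>2" by (simp add: power2_sum)
    finally have "norm (v - K *\<^sub>R u) \<le> K + \<eta>" using nn by (rule power2_le_imp_le)
    then show ?thesis using K(3) by (simp add: \<eta>_def)
  qed
  have qc: "((\<lambda>t. (c t - p) /\<^sub>R t) \<longlongrightarrow> v) (at_right 0)"
    using c(4) unfolding velocity_iff_at_right[OF c(1)] c(3) .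
  have qg: "((\<lambda>t. (g t - p) /\<^sub>R t) \<longlongrightarrow> u) (at_right 0)"
    using u(1) unfolding velocity_iff_at_right[OF g(2)] g0 .
  have Kt: "filterlim (\<lambda>t. K * t) (at_right 0) (at_right 0)"
    using filterlim_times_pos[OF filterlim_ident K(1), of "0::real" 0] by simp
  have qgK: "((\<lambda>t. K *\<^sub>R ((g (K * t) - p) /\<^sub>R (K * t))) \<longlongrightarrow> K *\<^sub>R u) (at_right 0)"
    by (intro tendsto_scaleR tendsto_const filterlim_compose[OF qg Kt])
  define n where "n t = norm (g (K * t) - c t)" for t
  have pos: "\<forall>\<^sub>F t in at_right (0::real). 0 < t" by (simp add: eventually_at_right_less)
  have nt: "((\<lambda>t. n t / t) \<longlongrightarrow> norm (v - K *\<^sub>R u)) (at_right 0)"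
  proof (rule Lim_transform_eventually[OF tendsto_norm[OF tendsto_diff[OF qc qgK]]])
    show "\<forall>\<^sub>F t in at_right 0. norm ((c t - p) /\<^sub>R t - K *\<^sub>R ((g (K * t) - p) /\<^sub>R (K * t))) = n t / t"
      using pos
    proof eventually_elim
      case (elim t)
      have "(c t - p) /\<^sub>R t - K *\<^sub>R ((g (K * t) - p) /\<^sub>R (K * t)) = (c t - g (K * t)) /\<^sub>R t"
      proof -
        have "K * inverse (K * t) = inverse t" using K(1) elim by (simp add: field_simps)
        then show ?thesis by (simp only: scaleR_scaleR) (simp add: scaleR_diff_right)
      qed
      then show ?case using elim by (simp add: n_def divide_inverse norm_minus_commute mult.commute)
    qed
  qed
  have t0: "((\<lambda>t::real. t) \<longlongrightarrow> 0) (at_right 0)" by (simp add: tendsto_ident_at)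
  have "((\<lambda>t. n t / t + C * (n t / t)\<^sup>2 * t) \<longlongrightarrow> norm (v - K *\<^sub>R u) + C * (norm (v - K *\<^sub>R u))\<^sup>2 * 0) (at_right 0)"
    by (intro tendsto_intros nt t0)
  then have "\<forall>\<^sub>F t in at_right 0. n t / t + C * (n t / t)\<^sup>2 * t < K + (\<epsilon> - u \<bullet> v)"
    using slope by (intro order_tendstoD(2)) auto
  moreover have "\<forall>\<^sub>F t in at_right 0. K * t < l"
    using order_tendstoD(2)[OF tendsto_mult_right_zero[OF t0, of K] g(2)] .
  moreover have "\<forall>\<^sub>F t in at_right 0. K * t < \<delta>"
    using order_tendstoD(2)[OF tendsto_mult_right_zero[OF t0, of K] \<delta>(1)] .
  moreover have "\<forall>\<^sub>F t in at_right 0. t < e" using order_tendstoD(2)[OF t0 c(1)] .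
  moreover have "\<forall>\<^sub>F t in at_right 0. norm ((c t - p) /\<^sub>R t) * t < \<delta>"
    using order_tendstoD(2)[OF tendsto_mult[OF tendsto_norm[OF qc] t0], of \<delta>] \<delta>(1) by simp
  ultimately show ?thesis using pos
  proof eventually_elim
    case (elim t)
    have t: "t \<in> {0..e}" "K * t \<in> {0..l}" using elim K by auto
    have "norm ((c t - p) /\<^sub>R t) * t = norm (c t - p)"
      using \<open>0 < t\<close> by (simp add: mult.commute[of _ t] flip: mult.assoc)
    then have "norm (c t - p) < \<delta>" using elim by (simp only:)
    then have cb: "c t \<in> M \<inter> ball p \<delta>" using c(2) t by (auto simp: dist_norm norm_minus_commute)
    have "norm (g (K * t) - p) < \<delta>"
      using shortest_arc_dist_le[OF g(1), of 0 "K * t"] t g0 g(2) elim by simp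
    then have gb: "g (K * t) \<in> M \<inter> ball p \<delta>" using gM t by (auto simp: dist_norm norm_minus_commute)
    have 1: "geodist M (c t) (g (K * t)) \<le> ennreal (n t + C * (n t)\<^sup>2)"
      unfolding n_def by (rule le[OF cb gb])
    have 2: "geodist M (g (K * t)) r \<le> ennreal (l - K * t)"
      using g(1) t gl g(2) unfolding shortest_arc_def by auto
    have "geodist M (c t) r \<le> ennreal (n t + C * (n t)\<^sup>2 + (l - K * t))"
      using \<delta>(2) t by (intro geodist_triangle_le[OF 1 2]) (auto simp: n_def)
    moreover have "n t + C * (n t)\<^sup>2 = (n t / t + C * (n t / t)\<^sup>2 * t) * t"
      using elim by (simp add: field_simps power2_eq_square)
    then have "n t + C * (n t)\<^sup>2 \<le> (K + (\<epsilon> - u \<bullet> v)) * t"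
      using elim by (auto intro: mult_right_mono)
    then have "n t + C * (n t)\<^sup>2 + (l - K * t) \<le> l + t * (\<epsilon> - u \<bullet> v)" by (simp add: algebra_simps)
    moreover have "0 \<le> n t + C * (n t)\<^sup>2 + (l - K * t)" using \<delta>(2) t by (simp add: n_def)
    ultimately show ?case by (meson ennreal_leI order_trans)
  qed
qed

text \<open>The balance condition. The sum \<open>v\<close> of the weighted directions is itself a tangent vector, so it is the velocity of a curve
  on the surface. By the first variation the weighted sum of distances would decrease along this curve at a rate of at least
  \<open>(v \<bullet> v) / 2\<close> if \<open>v\<close> were nonzero.\<close>

lemma FT_point_tangent_sum_eq_0:
  assumes M: "C2_surface M" and FT: "FT_point M a b c d wa wb wc wd p"
    and w: "0 < wa" "0 < wb" "0 < wc" "0 < wd"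
    and a': "tangent_ray_point M p a wa a'" and b': "tangent_ray_point M p b wb b'"
    and c': "tangent_ray_point M p c wc c'" and d': "tangent_ray_point M p d wd d'"
  shows "a' + b' + c' + d' = 0"
proof (rule ccontr)
  define v where "v = a' + b' + c' + d'"
  assume "a' + b' + c' + d' \<noteq> 0"
  then have v0: "0 < v \<bullet> v" by (simp add: v_def)
  have p: "p \<in> M" using FT by (simp add: FT_point_def)
  obtain f :: "real^2 \<Rightarrow> real^3" where f: "linear f" "tangent_plane M p = range f"
    using tangent_plane_eq_range[OF M p] by metis
  have "subspace (tangent_plane M p)" unfolding f(2) using f(1) by (intro linear_subspace_image) auto
  then have "v \<in> tangent_plane M p"
    using a' b' c' d' unfolding v_def tangent_ray_point_def by (intro subspace_add) auto
  then obtain \<gamma> e where \<gamma>: "0 < e" "\<gamma> ` {-e<..<e} \<subseteq> M" "\<gamma> 0 = p" "(\<gamma> has_vector_derivative v) (at 0)"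
    unfolding tangent_plane_def by blast
  have sub: "{0..e/2} \<subseteq> {-e<..<e}" using \<gamma>(1) by auto
  have \<gamma>M: "\<gamma> ` {0..e/2} \<subseteq> M" using \<gamma>(2) sub by blast
  have \<gamma>': "(\<gamma> has_vector_derivative v) (at 0 within {0..e/2})"
    using \<gamma>(4) by (rule has_vector_derivative_at_within)
  have e2: "0 < e/2" using \<gamma>(1) by simp
  \<comment> \<open>the four errors together use up half of the gain \<open>v \<bullet> v\<close>\<close>
  define \<epsilon> where "\<epsilon> = (v \<bullet> v) / (2 * (wa + wb + wc + wd))"
  have \<epsilon>: "0 < \<epsilon>" using v0 w by (simp add: \<epsilon>_def)
  have variation: "\<exists>l u. 0 \<le> l \<and> geodist M p r = ennreal l \<and> r' = w *\<^sub>R u \<and>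
      (\<forall>\<^sub>F t in at_right 0. geodist M (\<gamma> t) r \<le> ennreal (l + t * (\<epsilon> - u \<bullet> v)) \<and> 0 \<le> l + t * (\<epsilon> - u \<bullet> v))"
    if r: "tangent_ray_point M p r w r'" and w0: "0 < w" for r w r'
  proof -
    obtain g l u where g: "shortest_arc M g l p r" "0 < l" "norm u = 1"
      "(g has_vector_derivative u) (at 0 within {0..l})" "r' = w *\<^sub>R u"
      using tangent_ray_pointE[OF M p r w0] by metis
    have "geodist M (g 0) (g l) = ennreal \<bar>0 - l\<bar>" "g 0 = p" "g l = r"
      using g(1,2) unfolding shortest_arc_def by auto
    then have "geodist M p r = ennreal l" using g(2) by simp
    then show ?thesis using g(2,5) first_variation_le[OF M g(1,2,4,3) e2 \<gamma>M \<gamma>(3) \<gamma>' \<epsilon>]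
      by (intro exI[of _ l] exI[of _ u]) simp
  qed
  obtain la ua where a: "0 \<le> la" "geodist M p a = ennreal la" "a' = wa *\<^sub>R ua"
    "\<forall>\<^sub>F t in at_right 0. geodist M (\<gamma> t) a \<le> ennreal (la + t * (\<epsilon> - ua \<bullet> v)) \<and> 0 \<le> la + t * (\<epsilon> - ua \<bullet> v)"
    using variation[OF a' w(1)] by blast
  obtain lb ub where b: "0 \<le> lb" "geodist M p b = ennreal lb" "b' = wb *\<^sub>R ub"
    "\<forall>\<^sub>F t in at_right 0. geodist M (\<gamma> t) b \<le> ennreal (lb + t * (\<epsilon> - ub \<bullet> v)) \<and> 0 \<le> lb + t * (\<epsilon> - ub \<bullet> v)"
    using variation[OF b' w(2)] by blast
  obtain lc uc where c: "0 \<le> lc" "geodist M p c = ennreal lc" "c' = wc *\<^sub>R uc"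
    "\<forall>\<^sub>F t in at_right 0. geodist M (\<gamma> t) c \<le> ennreal (lc + t * (\<epsilon> - uc \<bullet> v)) \<and> 0 \<le> lc + t * (\<epsilon> - uc \<bullet> v)"
    using variation[OF c' w(3)] by blast
  obtain ld ud where d: "0 \<le> ld" "geodist M p d = ennreal ld" "d' = wd *\<^sub>R ud"
    "\<forall>\<^sub>F t in at_right 0. geodist M (\<gamma> t) d \<le> ennreal (ld + t * (\<epsilon> - ud \<bullet> v)) \<and> 0 \<le> ld + t * (\<epsilon> - ud \<bullet> v)"
    using variation[OF d' w(4)] by blast
  have "\<forall>\<^sub>F t in at_right 0. t < e/2"
    using order_tendstoD(2)[OF _ e2, of "\<lambda>t. t" "at_right 0"] by (simp add: tendsto_ident_at)
  moreover have "\<forall>\<^sub>F t in at_right (0::real). 0 < t" by (simp add: eventually_at_right_less)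
  ultimately have "\<forall>\<^sub>F t in at_right (0::real). False"
    using a(4) b(4) c(4) d(4)
  proof eventually_elim
    case (elim t)
    define xa xb xc xd where "xa = la + t * (\<epsilon> - ua \<bullet> v)" and "xb = lb + t * (\<epsilon> - ub \<bullet> v)"
      and "xc = lc + t * (\<epsilon> - uc \<bullet> v)" and "xd = ld + t * (\<epsilon> - ud \<bullet> v)"
    have x0: "0 \<le> xa" "0 \<le> xb" "0 \<le> xc" "0 \<le> xd"
      using elim by (simp_all add: xa_def xb_def xc_def xd_def)
    have "\<gamma> t \<in> M" using \<gamma>M elim by (simp add: image_subset_iff)
    then have "FT_function M a b c d wa wb wc wd p \<le> FT_function M a b c d wa wb wc wd (\<gamma> t)"
      using FT by (simp add: FT_point_def)
    also have "\<dots> \<le> ennreal wa * ennreal xa + ennreal wb * ennreal xb + ennreal wc * ennreal xc + ennreal wd * ennreal xd"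
      unfolding FT_function_def xa_def xb_def xc_def xd_def
      using elim by (intro add_mono mult_left_mono) auto
    also have "\<dots> = ennreal (wa * xa + wb * xb + wc * xc + wd * xd)"
      using w x0 by (simp flip: ennreal_mult)
    finally have "ennreal (wa * la + wb * lb + wc * lc + wd * ld) \<le> ennreal (wa * xa + wb * xb + wc * xc + wd * xd)"
      using w a b c d by (simp add: FT_function_def flip: ennreal_mult)
    moreover have "0 \<le> wa * xa + wb * xb + wc * xc + wd * xd" using w x0 by simp
    ultimately have "wa * la + wb * lb + wc * lc + wd * ld \<le> wa * xa + wb * xb + wc * xc + wd * xd"
      by (simp only: ennreal_le_iff)
    then have "0 \<le> t * ((wa + wb + wc + wd) * \<epsilon> - (a' + b' + c' + d') \<bullet> v)"
      by (simp add: a(3) b(3) c(3) d(3) xa_def xb_def xc_def xd_def algebra_simps)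
    then have "0 \<le> (wa + wb + wc + wd) * \<epsilon> - v \<bullet> v"
      using elim by (simp add: v_def zero_le_mult_iff)
    moreover have "(wa + wb + wc + wd) * \<epsilon> = (v \<bullet> v) / 2"
    proof -
      have "W * (x / (2 * W)) = x / 2" if "0 < W" for W x :: real using that by simp
      then show ?thesis using w unfolding \<epsilon>_def by (metis add_pos_pos)
    qed
    ultimately show False using v0 by simp
  qed
  then show False by simp
qed

section \<open>Geodesic polar coordinates\<close>

lemma shortest_arc_geodist:
  assumes "shortest_arc M g l p q"
  shows "geodist M p q = ennreal l" "geodist M q p = ennreal l" "0 \<le> l" "g 0 = p" "g l = q"
proof -
  have *: "0 \<le> l" "g 0 = p" "g l = q"
    "\<And>s t. s \<in> {0..l} \<Longrightarrow> t \<in> {0..l} \<Longrightarrow> geodist M (g s) (g t) = ennreal \<bar>s - t\<bar>"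
    using assms unfolding shortest_arc_def by auto
  show "0 \<le> l" "g 0 = p" "g l = q" by (fact *)+
  show "geodist M p q = ennreal l" "geodist M q p = ennreal l" using *(1-3) *(4)[of 0 l] *(4)[of l 0] by auto
qed

lemma shortest_arc_reverse:
  assumes "shortest_arc M g l p q"
  shows "shortest_arc M (\<lambda>t. g (l - t)) l q p"
proof -
  have img: "(\<lambda>t. g (l - t)) ` {0..l} \<subseteq> g ` {0..l}" by force
  show ?thesis using assms img unfolding shortest_arc_def by (auto simp: abs_minus_commute)
qed

text \<open>A geodesic has the right length locally; by the triangle inequality and a subdivision of the parameter interval the bound
  holds globally.\<close>

lemma geodesic_from_geodist_le:
  assumes "geodesic_from M p v c"
  shows "geodist M p (c 1) \<le> ennreal (norm v)"
proof -
  have c0: "c 0 = p" and loc: "\<And>t. t \<in> {0..1} \<Longrightarrow> \<exists>e>0. \<forall>s\<in>{0..1} \<inter> ball t e. \<forall>s'\<in>{0..1} \<inter> ball t e.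
        geodist M (c s) (c s') = ennreal (norm v * \<bar>s - s'\<bar>)"
    using assms unfolding geodesic_from_def by auto
  define P where "P s t \<longleftrightarrow> (0 \<le> s \<and> s \<le> t \<and> t \<le> 1 \<longrightarrow> geodist M (c s) (c t) \<le> ennreal (norm v * (t - s)))" for s t
  have "P 0 1"
  proof (rule Bolzano)
    fix r s t assume P: "P r s" "P s t" and le: "r \<le> s" "s \<le> t"
    show "P r t" unfolding P_def
    proof
      assume "0 \<le> r \<and> r \<le> t \<and> t \<le> 1"
      then have 1: "geodist M (c r) (c s) \<le> ennreal (norm v * (s - r))"
        and 2: "geodist M (c s) (c t) \<le> ennreal (norm v * (t - s))"
        using P le unfolding P_def by auto
      have "geodist M (c r) (c t) \<le> ennreal (norm v * (s - r) + norm v * (t - s))"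
        using le by (intro geodist_triangle_le[OF 1 2]) auto
      then show "geodist M (c r) (c t) \<le> ennreal (norm v * (t - r))" by (simp add: algebra_simps)
    qed
  next
    fix x :: real assume "0 \<le> x" "x \<le> 1"
    then obtain e where e: "e > 0" and
      eq: "\<And>s s'. s \<in> {0..1} \<inter> ball x e \<Longrightarrow> s' \<in> {0..1} \<inter> ball x e \<Longrightarrow>
        geodist M (c s) (c s') = ennreal (norm v * \<bar>s - s'\<bar>)"
      using loc[of x] by auto
    show "\<exists>d>0. \<forall>a b. a \<le> x \<and> x \<le> b \<and> b - a < d \<longrightarrow> P a b"
    proof (intro exI[of _ e] conjI allI impI e)
      fix a b assume ab: "a \<le> x \<and> x \<le> b \<and> b - a < e"
      show "P a b" unfolding P_def
      proof
        assume "0 \<le> a \<and> a \<le> b \<and> b \<le> 1"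
        then show "geodist M (c a) (c b) \<le> ennreal (norm v * (b - a))"
          using ab eq[of a b] by (auto simp: dist_real_def)
      qed
    qed
  qed simp
  then show ?thesis using c0 by (simp add: P_def)
qed

text \<open>The exponential map at \<open>p\<close> read in the Euclidean plane through a linear isometry \<open>J\<close> onto the tangent plane. The two
  facts kept about geodesics are that a radius is at least as long as the distance of its ends and that a shortest arc
  from \<open>p\<close> is a ray in the direction of its initial velocity.\<close>

locale polar_chart =
  fixes M :: "(real^3) set" and p :: "real^3" and R :: real
    and J :: "real^2 \<Rightarrow> real^3" and E :: "real^2 \<Rightarrow> real^3"
  assumes C2: "C2_surface M" and p_in: "p \<in> M" and R_pos: "0 < R"
    and J_linear: "linear J" and J_norm: "\<And>x. norm (J x) = norm x" and J_range: "range J = tangent_plane M p"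
    and E_cont: "continuous_on (ball 0 R) E" and E_inj: "inj_on E (ball 0 R)"
    and E_0: "E 0 = p" and E_in: "E ` ball 0 R \<subseteq> M"
    and E_geodist_le: "\<And>v. norm v < R \<Longrightarrow> geodist M p (E v) \<le> ennreal (norm v)"
    and arc_eq_E: "\<And>g l q x t. \<lbrakk>shortest_arc M g l p q; 0 < l;
      (g has_vector_derivative J x) (at 0 within {0..l}); 0 \<le> t; t \<le> l; t < R\<rbrakk> \<Longrightarrow> g t = E (t *\<^sub>R x)"

text \<open>A shortest arc with initial velocity \<open>u\<close> is a geodesic with this velocity, so uniqueness of the exponential map forces it
  to be the ray in direction \<open>u\<close>.\<close>

lemma polar_chart_exists:
  assumes M: "C2_surface M" "p \<in> M" and r: "normal_radius M p r" and R: "0 < R" "R \<le> r"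
  obtains J E where "polar_chart M p R J E"
proof -
  obtain f :: "real^2 \<Rightarrow> real^3" where f: "linear f" "inj f" "tangent_plane M p = range f"
    using tangent_plane_eq_range[OF M] by metis
  have "dim (range f) = dim (UNIV :: (real^2) set)" using f(1,2) by (intro dim_image_eq) auto
  moreover have "subspace (range f)" using f(1) by (intro linear_subspace_image) auto
  ultimately obtain J :: "real^2 \<Rightarrow> real^3" where J: "linear J" "range J = range f" "\<And>x. norm (J x) = norm x"
    using isometry_subspaces[of "UNIV :: (real^2) set" "range f"] by auto
  define B where "B = {v \<in> tangent_plane M p. norm v < r}"
  have ex1: "\<exists>!q. exp_graph M p v q" if "v \<in> B" for v
    using r that unfolding normal_radius_def Let_def B_def by blast
  obtain h where h: "homeomorphism B (exp_map M p ` B) (exp_map M p) h"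
    using r unfolding normal_radius_def Let_def B_def by blast
  define E where "E = exp_map M p \<circ> J"
  have JB: "J x \<in> B" if "norm x < R" for x
    using that R J(2,3) f(3) by (auto simp: B_def)
  then have JB': "J ` ball 0 R \<subseteq> B" by auto
  have E_eq: "E x = q" if "norm x < R" "exp_graph M p (J x) q" for x q
    unfolding E_def exp_map_def using ex1[OF JB[OF that(1)]] that(2) by (auto intro: the1_equality)
  have graph: "exp_graph M p (J x) (E x)" if "norm x < R" for x
    unfolding E_def exp_map_def using theI'[OF ex1[OF JB[OF that]]] by simp
  have "geodesic_from M p 0 (\<lambda>_. p)"
    unfolding geodesic_from_def using M(2) by (auto simp: geodist_refl intro: exI[of _ 1])
  then have "exp_graph M p (J 0) p" unfolding exp_graph_def linear_0[OF J(1)] by blast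
  then have E0: "E 0 = p" using R by (intro E_eq) auto
  have injJ: "inj J" using J(1,3) linear_injective_0 by (metis norm_eq_zero)
  show thesis
  proof (rule that, unfold_locales)
    show "range J = tangent_plane M p" using J f by simp
    show "continuous_on (ball 0 R) E" unfolding E_def
      using J(1) by (intro continuous_on_compose continuous_on_subset[OF homeomorphism_cont1[OF h] JB'])
        (simp add: linear_continuous_on linear_conv_bounded_linear)
    show "inj_on E (ball 0 R)" unfolding E_def
    proof (rule comp_inj_on)
      show "inj_on J (ball 0 R)" using injJ by (rule inj_on_subset) simp
      have "inj_on (exp_map M p) B" using homeomorphism_apply1[OF h] by (metis inj_onI)
      then show "inj_on (exp_map M p) (J ` ball 0 R)" using JB' by (rule inj_on_subset)
    qed
    show "E ` ball 0 R \<subseteq> M"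
    proof clarify
      fix x :: "real^2" assume "x \<in> ball 0 R"
      then have "exp_graph M p (J x) (E x)" by (intro graph) simp
      then obtain c where "geodesic_from M p (J x) c" "c 1 = E x" unfolding exp_graph_def by blast
      then have "c ` {0..1} \<subseteq> M" "c 1 = E x" unfolding geodesic_from_def by simp_all
      then show "E x \<in> M" by (metis atLeastAtMost_iff image_subset_iff order_refl zero_le_one)
    qed
    show "geodist M p (E v) \<le> ennreal (norm v)" if "norm v < R" for v
      using graph[OF that] geodesic_from_geodist_le J(3) unfolding exp_graph_def by metis
    show "g t = E (t *\<^sub>R x)"
      if g: "shortest_arc M g l p q" "0 < l" and x: "(g has_vector_derivative J x) (at 0 within {0..l})"
        and t: "0 \<le> t" "t \<le> l" "t < R" for g l q x t
    proof (cases "t = 0")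
      case True
      then show ?thesis using E0 shortest_arc_geodist(4)[OF g(1)] by simp
    next
      case False
      obtain u where u: "norm u = 1" "(g has_vector_derivative u) (at 0 within {0..l})"
        using shortest_arc_initial_direction[OF M g] by metis
      have nJ: "norm (J x) = 1" using initial_direction_unique[OF x u(2) g(2)] u(1) by simp
      have "exp_graph M p (t *\<^sub>R J x) (g t)"
        using shortest_arc_exp_graph[OF g x nJ] t False by simp
      then show ?thesis
        using E_eq[of "t *\<^sub>R x" "g t"] t nJ J(3) by (simp add: linear_scale[OF J(1)])
    qed
  qed (use M R J E0 in \<open>auto simp: linear_add linear_scale\<close>)
qed

context polar_chart
begin

lemma open_E: "open V \<Longrightarrow> V \<subseteq> ball 0 R \<Longrightarrow> openin (top_of_set M) (E ` V)"
  using E_cont E_inj E_in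
  by (intro openin_inj_image_surface[OF C2]) (auto intro: continuous_on_subset inj_on_subset)

lemma arc_polar:
  assumes g: "shortest_arc M g l p q" "0 < l"
  obtains x where "norm x = 1" "(g has_vector_derivative J x) (at 0 within {0..l})"
    "\<And>t. 0 \<le> t \<Longrightarrow> t \<le> l \<Longrightarrow> t < R \<Longrightarrow> g t = E (t *\<^sub>R x)"
proof -
  obtain u where u: "norm u = 1" "(g has_vector_derivative u) (at 0 within {0..l})" "u \<in> tangent_plane M p"
    using shortest_arc_initial_direction[OF C2 p_in g] by metis
  then obtain x where "u = J x" using J_range by auto
  then show thesis using that[of x] arc_eq_E[OF g] u J_norm by auto
qed

text \<open>A shortest arc to \<open>E v\<close> is no longer than \<open>norm v\<close>, so it is a ray that stays in the domain of the chart;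
  injectivity identifies its end with \<open>v\<close>. Hence a shortest arc to a point of the chart can only be the radius.\<close>

lemma arc_to_E:
  assumes g: "shortest_arc M g l p (E v)" and v: "norm v < R"
  shows "l = norm v" "\<And>s. 0 \<le> s \<Longrightarrow> s \<le> 1 \<Longrightarrow> g (s * l) = E (s *\<^sub>R v)"
proof -
  have l: "0 \<le> l" "g 0 = p" "g l = E v" "geodist M p (E v) = ennreal l"
    using shortest_arc_geodist[OF g] by auto
  then have lv: "l \<le> norm v" using E_geodist_le[OF v] by simp
  have "l = norm v \<and> (\<forall>s. 0 \<le> s \<and> s \<le> 1 \<longrightarrow> g (s * l) = E (s *\<^sub>R v))"
  proof (cases "l = 0")
    case True
    then have "E v = E 0" using l E_0 by simp
    then have "v = 0" using E_inj v R_pos unfolding inj_on_def by (metis dist_0_norm mem_ball norm_zero)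
    then show ?thesis using True l E_0 by simp
  next
    case False
    then have l0: "0 < l" using l by simp
    obtain x where x: "norm x = 1" "\<And>t. 0 \<le> t \<Longrightarrow> t \<le> l \<Longrightarrow> t < R \<Longrightarrow> g t = E (t *\<^sub>R x)"
      using arc_polar[OF g l0] by metis
    have "E (l *\<^sub>R x) = E v" using x(2)[of l] l0 lv v l by simp
    moreover have "norm (l *\<^sub>R x) < R" using x(1) l0 lv v by simp
    ultimately have vx: "l *\<^sub>R x = v" using E_inj v unfolding inj_on_def by (metis dist_0_norm mem_ball)
    have "g (s * l) = E (s *\<^sub>R v)" if s: "0 \<le> s" "s \<le> 1" for s
    proof -
      have sl: "0 \<le> s * l" "s * l \<le> l" using s l0 by (auto intro: mult_left_le_one_le)
      then show ?thesis using x(2)[of "s * l"] lv v by (simp flip: vx)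
    qed
    moreover have "norm v = l" using vx x(1) l0 by auto
    ultimately show ?thesis by simp
  qed
  then show "l = norm v" "\<And>s. 0 \<le> s \<Longrightarrow> s \<le> 1 \<Longrightarrow> g (s * l) = E (s *\<^sub>R v)" by auto
qed

lemma convex_geodist_E:
  assumes Q: "geodesically_convex M Q" "p \<in> Q" and v: "E v \<in> Q" "norm v < R"
  shows "geodist M p (E v) = ennreal (norm v)"
proof -
  obtain g l where "shortest_arc M g l p (E v)" using Q v unfolding geodesically_convex_def by blast
  then show ?thesis using arc_to_E(1)[OF _ v(2)] shortest_arc_geodist(1) by blast
qed

text \<open>A convex set contains some shortest arc between two of its points, and there is just one.\<close>

lemma convex_starlike:
  assumes Q: "geodesically_convex M Q" "p \<in> Q" and v: "E v \<in> Q" "norm v < R" and s: "0 \<le> s" "s \<le> 1"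
  shows "E (s *\<^sub>R v) \<in> Q"
proof -
  obtain g l where g: "shortest_arc M g l p (E v)" "g ` {0..l} \<subseteq> Q"
    using Q v unfolding geodesically_convex_def by blast
  have "0 \<le> l" using shortest_arc_geodist(3)[OF g(1)] .
  then have "s * l \<in> {0..l}" using s by (auto intro: mult_left_le_one_le)
  then show ?thesis using arc_to_E(2)[OF g(1) v(2) s] g(2) by (metis image_subset_iff)
qed

lemma convex_in_range_E:
  assumes Q: "geodesically_convex M Q" "p \<in> Q" "q \<in> Q" and m: "geodist M p q \<le> ennreal m" "m < R" "0 \<le> m"
  obtains v where "norm v \<le> m" "q = E v"
proof -
  obtain g l where g: "shortest_arc M g l p q"
    using Q unfolding geodesically_convex_def by blast
  have l: "0 \<le> l" "g 0 = p" "g l = q" "geodist M p q = ennreal l" using shortest_arc_geodist[OF g] by auto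
  have lm: "l \<le> m" using l(4) m by (simp add: ennreal_le_iff)
  show thesis
  proof (cases "l = 0")
    case True
    then show thesis using that[of 0] m l E_0 by simp
  next
    case False
    then obtain x where x: "norm x = 1" "\<And>t. 0 \<le> t \<Longrightarrow> t \<le> l \<Longrightarrow> t < R \<Longrightarrow> g t = E (t *\<^sub>R x)"
      using arc_polar[OF g] l by (metis less_eq_real_def)
    show thesis using that[of "l *\<^sub>R x"] x(1) x(2)[of l] l lm m by simp
  qed
qed

text \<open>Suppose that \<open>Q\<close> has a point farther than \<open>m\<close> from \<open>p\<close>. Then some geodesic circle around \<open>p\<close> of radius \<open>\<rho>\<close> slightly larger
  than \<open>m\<close> meets \<open>Q\<close>. It is connected and avoids the boundary of \<open>Q\<close>, so it lies in \<open>Q\<close>, and by convexity so does the whole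
  disc. But then the boundary points, which lie in the open disc, would be interior.\<close>

lemma radius_bound:
  assumes Q: "geodesically_convex M Q" "p \<in> Q" and cl: "closedin (top_of_set M) Q"
    and ne: "top_of_set M frontier_of Q \<noteq> {}"
    and m: "\<And>y. y \<in> top_of_set M frontier_of Q \<Longrightarrow> geodist M p y \<le> ennreal m" "0 \<le> m" "m < R"
    and q: "q \<in> Q"
  shows "geodist M p q \<le> ennreal m"
proof (rule ccontr)
  let ?F = "top_of_set M frontier_of Q"
  have FQ: "?F \<subseteq> Q" using cl by (simp add: frontier_of_subset_closedin)
  assume far: "\<not> geodist M p q \<le> ennreal m"
  obtain g l where g: "shortest_arc M g l p q" "g ` {0..l} \<subseteq> Q"
    using Q q unfolding geodesically_convex_def by blast
  have l: "geodist M p q = ennreal l" using shortest_arc_geodist[OF g(1)] by auto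
  have lm: "m < l" using far l m by (simp add: ennreal_leI not_le[symmetric])
  \<comment> \<open>the cap \<open>(m + R) / 2\<close> keeps the circle inside the domain of the chart\<close>
  define \<rho> where "\<rho> = min l ((m + R) / 2)"
  have \<rho>: "m < \<rho>" "\<rho> < R" "\<rho> \<le> l" "0 < \<rho>" using lm m by (auto simp: \<rho>_def min_def)
  obtain x where x: "norm x = 1" "\<And>t. 0 \<le> t \<Longrightarrow> t \<le> l \<Longrightarrow> t < R \<Longrightarrow> g t = E (t *\<^sub>R x)"
    using arc_polar[OF g(1)] \<rho> by (metis less_le_trans)
  let ?S = "E ` sphere 0 \<rho>"
  have sub: "sphere 0 \<rho> \<subseteq> ball 0 R" using \<rho> by auto
  have "connected (sphere (0::real^2) \<rho>)" by (intro connected_sphere) simp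
  then have "connected ?S"
    using connected_continuous_image continuous_on_subset[OF E_cont sub] by blast
  then have conn: "connectedin (top_of_set M) ?S"
    using sub E_in by (auto simp: connectedin_subtopology)
  have "g \<rho> \<in> Q" using g(2) \<rho> by (simp add: image_subset_iff)
  then have "E (\<rho> *\<^sub>R x) \<in> Q" using x(2)[of \<rho>] \<rho> by simp
  moreover have "E (\<rho> *\<^sub>R x) \<in> ?S" using x(1) \<rho> by (intro imageI) simp
  ultimately have meet: "?S \<inter> Q \<noteq> {}" by blast
  have "?S \<inter> ?F = {}"
  proof (rule ccontr)
    assume "?S \<inter> ?F \<noteq> {}"
    then obtain v where "v \<in> sphere 0 \<rho>" and v2: "E v \<in> ?F" by blast
    then have v: "norm v = \<rho>" "E v \<in> ?F" by simp_all
    then have "ennreal \<rho> \<le> ennreal m"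
      using convex_geodist_E[OF Q, of v] FQ m(1)[OF v(2)] \<rho> by auto
    then show False using \<rho> m by (simp add: ennreal_le_iff)
  qed
  then have "?S - Q = {}" using connectedin_Int_frontier_of[OF conn meet] by blast
  have ball: "E ` ball 0 \<rho> \<subseteq> Q"
  proof clarify
    fix v :: "real^2" assume v: "v \<in> ball 0 \<rho>"
    obtain y s where y: "norm y = \<rho>" "0 \<le> s" "s \<le> 1" "v = s *\<^sub>R y"
    proof (cases "v = 0")
      case True
      then show thesis using that[of "\<rho> *\<^sub>R x" 0] x(1) \<rho> by simp
    next
      case False
      then show thesis
        using that[of "(\<rho> / norm v) *\<^sub>R v" "norm v / \<rho>"] v \<rho> by simp
    qed
    have "y \<in> sphere 0 \<rho>" using y(1) by simp
    then have "E y \<in> Q" using \<open>?S - Q = {}\<close> by blast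
    then show "E v \<in> Q" using convex_starlike[OF Q, of y s] y \<rho> by simp
  qed
  obtain y where y: "y \<in> ?F" using ne by blast
  obtain v where v: "norm v \<le> m" "y = E v"
    using convex_in_range_E[OF Q _ m(1)[OF y] m(3,2)] FQ y by blast
  have "openin (top_of_set M) (E ` ball 0 \<rho>)" using \<rho> by (intro open_E) auto
  then have "E ` ball 0 \<rho> \<subseteq> top_of_set M interior_of Q" using ball by (intro interior_of_maximal)
  moreover have "y \<in> E ` ball 0 \<rho>" using v \<rho> by auto
  ultimately show False using y by (auto simp: frontier_of_def)
qed

text \<open>The rays from \<open>p\<close> to a neighbourhood of the interior point \<open>q\<close> stay in \<open>Q\<close>. They fill a neighbourhood of every
  point of the ray to \<open>q\<close> other than \<open>p\<close>: in the chart it is the neighbourhood of \<open>q\<close> scaled towards the origin.\<close>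

lemma arc_to_interior:
  assumes Q: "geodesically_convex M Q" "p \<in> Q" and o: "q \<in> top_of_set M interior_of Q"
    and g: "shortest_arc M g l p q" "l < R" and t: "0 < t" "t \<le> l"
  shows "g t \<in> top_of_set M interior_of Q"
proof -
  let ?I = "top_of_set M interior_of Q"
  have l: "0 < l" "g l = q" using t shortest_arc_geodist[OF g(1)] by auto
  obtain x where x: "norm x = 1" "\<And>t. 0 \<le> t \<Longrightarrow> t \<le> l \<Longrightarrow> t < R \<Longrightarrow> g t = E (t *\<^sub>R x)"
    using arc_polar[OF g(1) l(1)] by metis
  obtain T where T: "open T" "?I = M \<inter> T"
    using openin_interior_of[of "top_of_set M" Q] unfolding openin_open by blast
  define O' where "O' = ball 0 R \<inter> E -` T"
  have O': "open O'" unfolding O'_def using E_cont T(1) by (intro continuous_open_preimage) auto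
  have EO': "E ` O' \<subseteq> ?I" using E_in T(2) by (auto simp: O'_def)
  define s where "s = t / l"
  have s: "0 < s" "s \<le> 1" using t l by (auto simp: s_def)
  have scaled: "(\<lambda>v. s *\<^sub>R v) ` O' \<subseteq> ball 0 R"
  proof clarify
    fix v assume "v \<in> O'"
    then have "norm v < R" by (simp add: O'_def)
    moreover have "s * norm v \<le> norm v" using s by (intro mult_left_le_one_le) auto
    ultimately show "s *\<^sub>R v \<in> ball 0 R" using s by simp
  qed
  have "open ((\<lambda>v. s *\<^sub>R v) ` O')" using O' s by (intro open_scaling) auto
  then have "openin (top_of_set M) (E ` (\<lambda>v. s *\<^sub>R v) ` O')" using scaled by (rule open_E)
  moreover have "E ` (\<lambda>v. s *\<^sub>R v) ` O' \<subseteq> Q"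
  proof clarify
    fix v assume v: "v \<in> O'"
    then have "E v \<in> Q" using EO' interior_of_subset[of "top_of_set M" Q] by blast
    then show "E (s *\<^sub>R v) \<in> Q" using v s by (intro convex_starlike[OF Q]) (auto simp: O'_def)
  qed
  ultimately have "E ` (\<lambda>v. s *\<^sub>R v) ` O' \<subseteq> ?I" by (intro interior_of_maximal)
  moreover have "g t \<in> E ` (\<lambda>v. s *\<^sub>R v) ` O'"
  proof -
    have "E (l *\<^sub>R x) = q" using x(2)[of l] l g(2) by simp
    then have "l *\<^sub>R x \<in> O'" using o T(2) x(1) l g(2) by (auto simp: O'_def)
    moreover have "g t = E (s *\<^sub>R (l *\<^sub>R x))" using x(2)[of t] t g(2) l by (simp add: s_def)
    ultimately show ?thesis by blast
  qed
  ultimately show ?thesis by blast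
qed

end

section \<open>The boundary of a convex region seen from an interior point\<close>

text \<open>Central projection from \<open>p\<close> identifies the boundary of \<open>Q\<close> with the circle of directions. The region lies within
  distance \<open>m\<close> of each of its boundary points, hence boundary points lie within \<open>m\<close> of \<open>p\<close>, and then the whole region does.
  Every ray from \<open>p\<close> has left \<open>Q\<close> before the radius exceeds the domain of the chart, so it meets the boundary.
  It meets it only once, because a point on the arc from a boundary point \<open>q\<close> to the interior point \<open>p\<close>, other than \<open>q\<close>,
  is interior. A continuous bijection from a compact space is a homeomorphism.\<close>

lemma boundary_radial_homeomorphism:
  assumes charts: "\<And>x. x \<in> M \<Longrightarrow> \<exists>J E. polar_chart M x R J E"
    and P: "polar_chart M p R J E" "p \<in> top_of_set M interior_of Q"
    and Q: "geodesically_convex M Q" "closedin (top_of_set M) Q" "top_of_set M frontier_of Q \<noteq> {}"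
    and m: "\<And>x y. x \<in> top_of_set M frontier_of Q \<Longrightarrow> y \<in> top_of_set M frontier_of Q \<Longrightarrow>
      geodist M x y \<le> ennreal m" "0 \<le> m" "m < R"
  obtains \<sigma> where "continuous_on (sphere 0 1) \<sigma>" "inj_on \<sigma> (sphere 0 1)"
    "\<sigma> ` sphere 0 1 = top_of_set M frontier_of Q"
    "\<And>x g l q. q \<in> top_of_set M frontier_of Q \<Longrightarrow> shortest_arc M g l p q \<Longrightarrow> 0 < l \<Longrightarrow> norm x = 1 \<Longrightarrow>
      (g has_vector_derivative J x) (at 0 within {0..l}) \<Longrightarrow> \<sigma> x = q"
proof -
  interpret polar_chart M p R J E by (rule P(1))
  let ?F = "top_of_set M frontier_of Q" and ?I = "top_of_set M interior_of Q"
  have FQ: "?F \<subseteq> Q" using Q(2) by (simp add: frontier_of_subset_closedin)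
  have QM: "Q \<subseteq> M" using Q(2) closedin_imp_subset by blast
  have IQ: "?I \<subseteq> Q" by (rule interior_of_subset)
  have pQ: "p \<in> Q" using P(2) IQ by blast
  have FI: "?F \<inter> ?I = {}" by (auto simp: frontier_of_def)
  have near: "geodist M p y \<le> ennreal m" if y: "y \<in> ?F" for y
  proof -
    have yQ: "y \<in> Q" using y FQ by blast
    obtain J' E' where y_chart: "polar_chart M y R J' E'" using charts yQ QM by blast
    have "geodist M y p \<le> ennreal m"
      using polar_chart.radius_bound[OF y_chart Q(1) yQ Q(2,3) m(1)[OF y] m(2,3) pQ] .
    moreover obtain g l where "shortest_arc M g l y p"
      using Q(1) yQ pQ unfolding geodesically_convex_def by blast
    ultimately show ?thesis using shortest_arc_geodist(1,2) by metis
  qed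
  have far: "geodist M p q \<le> ennreal m" if "q \<in> Q" for q
    using radius_bound[OF Q(1) pQ Q(2,3) near m(2,3) that] .
  have F_E: "\<exists>v. norm v \<le> m \<and> v \<noteq> 0 \<and> q = E v" if q: "q \<in> ?F" for q
  proof -
    obtain v where v: "norm v \<le> m" "q = E v"
      using convex_in_range_E[OF Q(1) pQ _ near[OF q] m(3,2)] q FQ by blast
    moreover have "q \<noteq> p" using q P(2) FI by blast
    ultimately show ?thesis using E_0 by metis
  qed
  have sub: "cball 0 m \<subseteq> ball 0 R" using m by auto
  obtain h where h: "homeomorphism (cball 0 m) (E ` cball 0 m) E h"
    using homeomorphism_compact[OF compact_cball continuous_on_subset[OF E_cont sub] refl inj_on_subset[OF E_inj sub]]
    by blast
  have hE: "h (E v) = v" if "norm v \<le> m" for v using homeomorphism_apply1[OF h] that by simp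
  have F_sub: "?F \<subseteq> E ` cball 0 m" using F_E by fastforce
  have h_cont: "continuous_on ?F h" using continuous_on_subset[OF homeomorphism_cont2[OF h] F_sub] .
  have h0: "norm (h q) \<le> m" "h q \<noteq> 0" "E (h q) = q" if "q \<in> ?F" for q
    using F_E[OF that] hE by auto
  have F_compact: "compact ?F"
  proof -
    obtain T where T: "closed T" "?F = M \<inter> T"
      using closedin_frontier_of[of "top_of_set M" Q] unfolding closedin_closed by blast
    then have "?F = E ` cball 0 m \<inter> T" using F_sub E_in sub by blast
    moreover have "compact (E ` cball 0 m)"
      using continuous_on_subset[OF E_cont sub] by (intro compact_continuous_image) auto
    ultimately show ?thesis using T(1) compact_Int_closed by metis
  qed
  have strict: "E (s *\<^sub>R h q) \<in> ?I" if q: "q \<in> ?F" and s: "0 \<le> s" "s < 1" for q s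
  proof -
    have qQ: "q \<in> Q" using q FQ by blast
    obtain g l where g: "shortest_arc M g l p q" using Q(1) pQ qQ unfolding geodesically_convex_def by blast
    have l: "l = norm (h q)" "\<And>s. 0 \<le> s \<Longrightarrow> s \<le> 1 \<Longrightarrow> g (s * l) = E (s *\<^sub>R h q)"
      using arc_to_E[of g l "h q"] g h0[OF q] m(3) by auto
    have l0: "0 < l" "l < R" using l(1) h0[OF q] m by auto
    obtain J' E' where q_chart: "polar_chart M q R J' E'" using charts qQ QM by blast
    \<comment> \<open>polar coordinates are used at the boundary point here, on the reversed arc\<close>
    have "g (l - (1 - s) * l) \<in> ?I"
      using polar_chart.arc_to_interior[OF q_chart Q(1) qQ P(2) shortest_arc_reverse[OF g] l0(2), of "(1 - s) * l"]
        l0 s by (auto intro: mult_left_le_one_le)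
    also have "g (l - (1 - s) * l) = E (s *\<^sub>R h q)" using l(2)[of s] s by (simp add: algebra_simps)
    finally show ?thesis .
  qed
  define \<theta> where "\<theta> q = h q /\<^sub>R norm (h q)" for q
  have "continuous_on ?F \<theta>"
    unfolding \<theta>_def using h0(2) by (intro continuous_intros h_cont) auto
  moreover have "inj_on \<theta> ?F"
  proof (rule inj_onI)
    have no_less: False if q: "q \<in> ?F" "q' \<in> ?F" "\<theta> q = \<theta> q'" and less: "norm (h q) < norm (h q')" for q q'
    proof -
      define s where "s = norm (h q) / norm (h q')"
      have "h q = norm (h q) *\<^sub>R \<theta> q" using h0(2)[OF q(1)] by (simp add: \<theta>_def)
      also have "\<dots> = s *\<^sub>R h q'" unfolding q(3) by (simp add: \<theta>_def s_def divide_inverse)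
      finally have "q = E (s *\<^sub>R h q')" using h0(3)[OF q(1)] by metis
      moreover have "0 \<le> s" "s < 1" using less by (auto simp: s_def divide_less_eq_1)
      ultimately show False using strict[OF q(2)] q(1) FI by blast
    qed
    fix q q' assume q: "q \<in> ?F" "q' \<in> ?F" "\<theta> q = \<theta> q'"
    have "norm (h q) = norm (h q')" using no_less[OF q] no_less[OF q(2,1) q(3)[symmetric]] by (meson linorder_neqE)
    then have "h q = h q'" using q(3) h0(2)[OF q(1)] h0(2)[OF q(2)] by (simp add: \<theta>_def)
    then show "q = q'" using h0(3) q by metis
  qed
  moreover have \<theta>_range: "\<theta> ` ?F = sphere 0 1"
  proof
    show "\<theta> ` ?F \<subseteq> sphere 0 1" using h0(2) by (auto simp: \<theta>_def)
    show "sphere 0 1 \<subseteq> \<theta> ` ?F"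
    proof
      fix x :: "real^2" assume "x \<in> sphere 0 1"
      then have x: "norm x = 1" by simp
      define r where "r = (m + R) / 2"
      have r: "m < r" "r < R" "0 \<le> r" using m by (auto simp: r_def)
      let ?S = "(\<lambda>t. E (t *\<^sub>R x)) ` {0..r}"
      have ray: "(\<lambda>t. t *\<^sub>R x) ` {0..r} \<subseteq> ball 0 R" using x r by auto
      have "continuous_on {0..r} (E \<circ> (\<lambda>t. t *\<^sub>R x))"
        by (intro continuous_on_compose continuous_intros continuous_on_subset[OF E_cont ray])
      then have "connected ?S" unfolding o_def by (rule connected_continuous_image) simp
      moreover have "?S \<subseteq> M" using E_in ray by blast
      ultimately have conn: "connectedin (top_of_set M) ?S" by (simp add: connectedin_subtopology)
      have "E (0 *\<^sub>R x) \<in> ?S" using r by (intro imageI) simp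
      then have meet: "?S \<inter> Q \<noteq> {}" using pQ E_0 by auto
      have "E (r *\<^sub>R x) \<notin> Q"
      proof
        assume rQ: "E (r *\<^sub>R x) \<in> Q"
        have "geodist M p (E (r *\<^sub>R x)) = ennreal r"
          using convex_geodist_E[OF Q(1) pQ rQ] x r by simp
        then show False using far[OF rQ] r m by (simp add: ennreal_le_iff)
      qed
      moreover have "E (r *\<^sub>R x) \<in> ?S" using r by (intro imageI) simp
      ultimately have "?S - Q \<noteq> {}" by blast
      then have "?S \<inter> ?F \<noteq> {}" by (rule connectedin_Int_frontier_of[OF conn meet])
      then obtain t where t: "0 \<le> t" "t \<le> r" "E (t *\<^sub>R x) \<in> ?F" by auto
      have "t \<noteq> 0" using t(3) E_0 P(2) FI by auto
      have "geodist M p (E (t *\<^sub>R x)) = ennreal t"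
        using convex_geodist_E[OF Q(1) pQ, of "t *\<^sub>R x"] t FQ x r by auto
      then have "t \<le> m" using near[OF t(3)] m(2) by (simp add: ennreal_le_iff)
      then have "h (E (t *\<^sub>R x)) = t *\<^sub>R x" using x t by (intro hE) simp
      then have "\<theta> (E (t *\<^sub>R x)) = x" using x t \<open>t \<noteq> 0\<close> by (simp add: \<theta>_def)
      then show "x \<in> \<theta> ` ?F" using t(3) by force
    qed
  qed
  ultimately obtain \<sigma> where \<sigma>: "homeomorphism ?F (sphere 0 1) \<theta> \<sigma>"
    using homeomorphism_compact[OF F_compact] by blast
  show thesis
  proof (rule that[of \<sigma>])
    show "continuous_on (sphere 0 1) \<sigma>" by (rule homeomorphism_cont2[OF \<sigma>])
    show "inj_on \<sigma> (sphere 0 1)" using homeomorphism_apply2[OF \<sigma>] by (metis inj_onI)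
    show "\<sigma> ` sphere 0 1 = ?F" by (rule homeomorphism_image2[OF \<sigma>])
    fix x g l q
    assume q: "q \<in> ?F" and g: "shortest_arc M g l p q" "0 < l" and x: "norm x = 1"
      and dg: "(g has_vector_derivative J x) (at 0 within {0..l})"
    have "ennreal l \<le> ennreal m" using near[OF q] shortest_arc_geodist(1)[OF g(1)] by simp
    then have lm: "l \<le> m" using m(2) by (simp add: ennreal_le_iff)
    then have "q = E (l *\<^sub>R x)"
      using arc_eq_E[OF g dg, of l] shortest_arc_geodist(5)[OF g(1)] g(2) m by simp
    then have "h q = l *\<^sub>R x" using hE[of "l *\<^sub>R x"] x lm g(2) by simp
    then have "\<theta> q = x" using x g(2) by (simp add: \<theta>_def)
    then show "\<sigma> x = q" using homeomorphism_apply1[OF \<sigma> q] by simp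
  qed
qed

lemma geodist_le_half:
  assumes "geodist M x y \<le> ennreal \<alpha>" "geodist M x y \<le> ennreal \<beta>" "\<alpha> + \<beta> \<le> L"
  shows "geodist M x y \<le> ennreal (L / 2)"
proof (cases "\<alpha> \<le> \<beta>")
  case True
  then show ?thesis using assms by (intro order_trans[OF assms(1)] ennreal_leI) simp
next
  case False
  then show ?thesis using assms by (intro order_trans[OF assms(2)] ennreal_leI) simp
qed

text \<open>The boundary is a closed curve whose length is the perimeter; of the two ways along it from \<open>x\<close> to \<open>y\<close>, one has at most
  half of this length. The point \<open>x\<close> is on the first side; the other cases follow by renaming the sides cyclically.\<close>

lemma quadrilateral_boundary_dist_le:
  assumes ab: "shortest_arc M gab lab a b" and bc: "shortest_arc M gbc lbc b c"
    and cd: "shortest_arc M gc lcd c d" and da: "shortest_arc M gda lda d a"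
    and x: "x \<in> gab ` {0..lab}"
    and y: "y \<in> gab ` {0..lab} \<union> gbc ` {0..lbc} \<union> gc ` {0..lcd} \<union> gda ` {0..lda}"
  shows "geodist M x y \<le> ennreal ((lab + lbc + lcd + lda) / 2)"
proof -
  define le where "le u v r \<longleftrightarrow> 0 \<le> r \<and> geodist M u v \<le> ennreal r" for u v r
  have le_trans: "le u w (r + s)" if "le u v r" "le v w s" for u v w r s
    using geodist_triangle_le[of M u v r w s] that by (simp add: le_def)
  have le_half: "geodist M x y \<le> ennreal ((lab + lbc + lcd + lda) / 2)"
    if "le x y \<alpha>" "le x y \<beta>" "\<alpha> + \<beta> \<le> lab + lbc + lcd + lda" for \<alpha> \<beta>
    using geodist_le_half that unfolding le_def by blast
  have arc: "le (g s) (g t) \<bar>s - t\<bar>" if "shortest_arc M g l u v" "s \<in> {0..l}" "t \<in> {0..l}" for g l u v s t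
    using that unfolding le_def shortest_arc_def by simp
  have ends: "le u (g t) t" "le (g t) u t" "le v (g t) (l - t)" "le (g t) v (l - t)" "le u v l" "le v u l"
    if "shortest_arc M g l u v" "t \<in> {0..l}" for g l u v t
  proof -
    have "0 \<le> l" "g 0 = u" "g l = v" using shortest_arc_geodist[OF that(1)] by auto
    then show "le u (g t) t" "le (g t) u t" "le v (g t) (l - t)" "le (g t) v (l - t)" "le u v l" "le v u l"
      using arc[OF that(1), of 0 t] arc[OF that(1), of t 0] arc[OF that(1), of l t] arc[OF that(1), of t l]
        arc[OF that(1), of 0 l] arc[OF that(1), of l 0] that(2) by (auto simp: abs_minus_commute)
  qed
  have l0: "0 \<in> {0..lab}" "0 \<in> {0..lbc}" "0 \<in> {0..lcd}" "0 \<in> {0..lda}"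
    using ab bc cd da unfolding shortest_arc_def by auto
  obtain s where s: "s \<in> {0..lab}" "x = gab s" using x by blast
  note x_ends = ends[OF ab s(1), folded s(2)]
  note sides = ends(5,6)[OF ab l0(1)] ends(5,6)[OF bc l0(2)] ends(5,6)[OF cd l0(3)] ends(5,6)[OF da l0(4)]
  from y consider t where "t \<in> {0..lab}" "y = gab t" | t where "t \<in> {0..lbc}" "y = gbc t"
    | t where "t \<in> {0..lcd}" "y = gc t" | t where "t \<in> {0..lda}" "y = gda t" by blast
  then show ?thesis
  proof cases
    case 1
    note y_ends = ends[OF ab 1(1), folded 1(2)]
    have direct: "le x y \<bar>s - t\<bar>" using arc[OF ab s(1) 1(1)] s 1 by simp
    show ?thesis
    proof (cases "s \<le> t")
      case True
      have "le x y (s + lda + lcd + lbc + (lab - t))"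
        by (rule le_trans x_ends(2) y_ends(3) sides)+
      from le_half[OF direct this] show ?thesis using True by simp
    next
      case False
      have "le x y (lab - s + lbc + lcd + lda + t)"
        by (rule le_trans x_ends(4) y_ends(1) sides)+
      from le_half[OF direct this] show ?thesis using False by simp
    qed
  next
    case 2
    note y_ends = ends[OF bc 2(1), folded 2(2)]
    have "le x y (lab - s + t)" "le x y (s + lda + lcd + (lbc - t))"
      by (rule le_trans x_ends(2,4) y_ends(1,3) sides)+
    then show ?thesis by (rule le_half) simp
  next
    case 3
    note y_ends = ends[OF cd 3(1), folded 3(2)]
    have "le x y (lab - s + lbc + t)" "le x y (s + lda + (lcd - t))"
      by (rule le_trans x_ends(2,4) y_ends(1,3) sides)+
    then show ?thesis by (rule le_half) simp
  next
    case 4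
    note y_ends = ends[OF da 4(1), folded 4(2)]
    have "le x y (lab - s + lbc + lcd + t)" "le x y (s + (lda - t))"
      by (rule le_trans x_ends(2,4) y_ends(1,3) sides)+
    then show ?thesis by (rule le_half) simp
  qed
qed

text \<open>The injectivity radius is the infimum over the surface, so any number strictly between \<open>m\<close> and it is below the radius
  of injectivity at each point.\<close>

lemma uniform_normal_radius:
  assumes "ennreal m < injectivity_radius M" "0 \<le> m"
  obtains R where "m < R" "\<And>x. x \<in> M \<Longrightarrow> \<exists>r\<ge>R. normal_radius M x r"
proof -
  obtain y where y: "ennreal m < y" "y < injectivity_radius M" using dense[OF assms(1)] by blast
  then obtain R where R: "0 \<le> R" "y = ennreal R" by (metis ennreal_cases infinity_ennreal_def less_top_ennreal order_less_imp_not_less top.extremum_strict)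
  have "\<exists>r\<ge>R. normal_radius M x r" if "x \<in> M" for x
  proof -
    have "ennreal R < injectivity_radius_at M x"
      using y(2) that unfolding R(2) injectivity_radius_def by (meson INF_lower less_le_trans)
    then obtain r where "0 < r" "normal_radius M x r" "ennreal R < ennreal r"
      unfolding injectivity_radius_at_def less_SUP_iff by blast
    then show ?thesis using R(1) by (intro exI[of _ r]) (auto simp: ennreal_less_iff)
  qed
  moreover have "m < R" using y(1) assms(2) unfolding R(2) by (simp add: ennreal_less_iff)
  ultimately show thesis using that by blast
qed

lemma quadrilateral_half_perimeter_less:
  assumes arcs: "shortest_arc M gab lab a b" "shortest_arc M gbc lbc b c"
      "shortest_arc M gc lcd c d" "shortest_arc M gda lda d a"
    and per: "perimeter M a b c d < 2 * injectivity_radius M"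
  shows "ennreal ((lab + lbc + lcd + lda) / 2) < injectivity_radius M"
proof (rule ccontr)
  let ?L = "lab + lbc + lcd + lda"
  have l0: "0 \<le> lab" "0 \<le> lbc" "0 \<le> lcd" "0 \<le> lda" using arcs shortest_arc_geodist(3) by blast+
  have "perimeter M a b c d = ennreal ?L"
    unfolding perimeter_def using l0
    by (simp add: shortest_arc_geodist(1)[OF arcs(1)] shortest_arc_geodist(1)[OF arcs(2)]
        shortest_arc_geodist(1)[OF arcs(3)] shortest_arc_geodist(1)[OF arcs(4)])
  also have "\<dots> = 2 * ennreal (?L / 2)"
  proof -
    have double: "ennreal x = 2 * ennreal (x / 2)" if "0 \<le> x" for x
      using ennreal_mult[of 2 "x / 2"] that by simp
    show ?thesis by (rule double) (use l0 in simp)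
  qed
  finally have "2 * ennreal (?L / 2) < 2 * injectivity_radius M" using per by simp
  moreover assume "\<not> ennreal (?L / 2) < injectivity_radius M"
  then have "2 * injectivity_radius M \<le> 2 * ennreal (?L / 2)"
    by (intro mult_left_mono) (simp_all only: not_less zero_le)
  ultimately show False by (simp only: leD)
qed

section \<open>The parallelogram\<close>

text \<open>The part of the closed curve in the directions of an open half plane is connected. If it contains
  \<open>\<sigma> a\<close> and \<open>\<sigma> c\<close> but neither \<open>\<sigma> b\<close> nor \<open>\<sigma> d\<close>, then the two closed parts \<open>S\<close> and \<open>T\<close>, which meet only there, would
  disconnect it.\<close>

lemma circle_order_not_separated:
  fixes \<sigma> :: "real^2 \<Rightarrow> 'a::topological_space" and n :: "real^2"
  assumes \<sigma>: "continuous_on (sphere 0 1) \<sigma>" "inj_on \<sigma> (sphere 0 1)"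
    and cover: "\<sigma> ` sphere 0 1 = S \<union> T" and closed: "closed S" "closed T" and ST: "S \<inter> T \<subseteq> {\<sigma> b, \<sigma> d}"
    and unit: "norm a = 1" "norm b = 1" "norm c = 1" "norm d = 1"
    and mem: "\<sigma> a \<in> S" "\<sigma> c \<in> T"
    and n: "0 < n \<bullet> a" "0 < n \<bullet> c" "n \<bullet> b \<le> 0" "n \<bullet> d \<le> 0"
  shows False
proof -
  define H where "H = {x. 0 < n \<bullet> x}"
  define K where "K = (\<lambda>x. \<sigma> (x /\<^sub>R norm x)) ` H"
  have H0: "x \<noteq> 0" if "x \<in> H" for x using that by (auto simp: H_def)
  have "continuous_on H (\<sigma> \<circ> (\<lambda>x. x /\<^sub>R norm x))"
  proof (rule continuous_on_compose)
    show "continuous_on H (\<lambda>x. x /\<^sub>R norm x)" using H0 by (intro continuous_intros) auto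
    show "continuous_on ((\<lambda>x. x /\<^sub>R norm x) ` H) \<sigma>"
      using \<sigma>(1) by (rule continuous_on_subset) (use H0 in auto)
  qed
  moreover have "connected H" unfolding H_def by (intro convex_connected convex_halfspace_gt)
  ultimately have "connected K" unfolding K_def o_def by (intro connected_continuous_image)
  moreover have "K \<subseteq> S \<union> T" unfolding K_def cover[symmetric] using H0 by auto
  moreover have "S \<inter> T \<inter> K = {}"
  proof -
    have "\<sigma> (x /\<^sub>R norm x) \<noteq> \<sigma> y" if x: "x \<in> H" and y: "norm y = 1" "n \<bullet> y \<le> 0" for x y
    proof
      assume "\<sigma> (x /\<^sub>R norm x) = \<sigma> y"
      then have "x /\<^sub>R norm x = y" using inj_onD[OF \<sigma>(2)] H0[OF x] y(1) by simp
      then have "n \<bullet> y = (n \<bullet> x) / norm x" by (auto simp: divide_inverse mult.commute)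
      also have "\<dots> > 0" using x H0[OF x] by (simp add: H_def)
      finally show False using y(2) by simp
    qed
    then show ?thesis using ST unit n unfolding K_def by blast
  qed
  moreover have "\<sigma> a \<in> K" unfolding K_def using unit n by (intro image_eqI[of _ _ a]) (auto simp: H_def)
  moreover have "\<sigma> c \<in> K" unfolding K_def using unit n by (intro image_eqI[of _ _ c]) (auto simp: H_def)
  ultimately show False using connected_closedD[of K S T] closed mem by blast
qed

text \<open>Collinearity means that \<open>a + b\<close> and \<open>b + c\<close> are multiples of one vector. A normal \<open>n\<close> of this vector
  sees \<open>a\<close> and \<open>c\<close> on one side and, as the sum vanishes, \<open>b\<close> and \<open>d\<close> at the same height on the other.\<close>

lemma collinear_isometric_image_normal:
  fixes J :: "real^2 \<Rightarrow> 'a::real_normed_vector"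
  assumes J: "linear J" "\<And>x. norm (J x) = norm x"
    and col: "collinear {- J a, J b, - J c}" and sum: "J a + J b + J c + J d = 0"
  obtains n where "n \<noteq> 0" "n \<bullet> c = n \<bullet> a" "n \<bullet> b = - (n \<bullet> a)" "n \<bullet> d = - (n \<bullet> a)"
proof -
  have J0: "x = 0" if "J x = 0" for x using J(2)[of x] that by simp
  obtain U where U: "\<And>x y. x \<in> {- J a, J b, - J c} \<Longrightarrow> y \<in> {- J a, J b, - J c} \<Longrightarrow> \<exists>k. x - y = k *\<^sub>R U"
    using col unfolding collinear_def by metis
  obtain \<alpha> \<beta> where "J b - - J a = \<alpha> *\<^sub>R U" "J b - - J c = \<beta> *\<^sub>R U"
    using U[of "J b" "- J a"] U[of "J b" "- J c"] by auto
  then have \<alpha>: "J (b + a) = \<alpha> *\<^sub>R U" and \<beta>: "J (b + c) = \<beta> *\<^sub>R U"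
    by (simp_all add: linear_add[OF J(1)])
  obtain u where u: "\<exists>k. b + a = k *\<^sub>R u" "\<exists>k. b + c = k *\<^sub>R u"
  proof (cases "\<alpha> = 0")
    case True
    then have "b + a = 0" using \<alpha> J0 by simp
    then show thesis using that[of "b + c"] by (metis scaleR_one scaleR_zero_left)
  next
    case False
    have "J (b + c - (\<beta> / \<alpha>) *\<^sub>R (b + a)) = 0"
      using \<alpha> \<beta> False by (simp add: linear_diff[OF J(1)] linear_scale[OF J(1)])
    then have "b + c = (\<beta> / \<alpha>) *\<^sub>R (b + a)" using J0 by (metis eq_iff_diff_eq_0)
    then show thesis using that[of "b + a"] by (metis scaleR_one)
  qed
  obtain n where n: "n \<noteq> 0" "orthogonal u n" using orthogonal_to_vector_exists[of u] by auto
  then have "n \<bullet> (b + a) = 0" "n \<bullet> (b + c) = 0"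
    using u by (auto simp: orthogonal_def inner_commute)
  moreover have "J (a + b + c + d) = 0" using sum by (simp add: linear_add[OF J(1)])
  then have "a + b + c + d = 0" by (rule J0)
  then have "n \<bullet> (a + b + c + d) = 0" by simp
  ultimately show thesis using n(1) by (intro that[of n]) (auto simp: inner_add_right)
qed

text \<open>The determinant \<open>D\<close> of \<open>x\<close> and \<open>y\<close> vanishes, and Lagrange's identity then makes their inner product \<open>1\<close> or \<open>-1\<close>.\<close>

lemma unit_vectors_orthogonal_to_normal:
  fixes n x y :: "real^2"
  assumes "n \<noteq> 0" "n \<bullet> x = 0" "n \<bullet> y = 0" "norm x = 1" "norm y = 1"
  shows "x = y \<or> x = - y"
proof -
  define D where "D = x$1 * y$2 - x$2 * y$1"
  have nx: "n$1 * x$1 + n$2 * x$2 = 0" and ny: "n$1 * y$1 + n$2 * y$2 = 0"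
    using assms(2,3) by (simp_all add: inner_vec_def sum_2)
  have "n$1 * D = (n$1 * x$1 + n$2 * x$2) * y$2 - (n$1 * y$1 + n$2 * y$2) * x$2"
    and "n$2 * D = (n$1 * y$1 + n$2 * y$2) * x$1 - (n$1 * x$1 + n$2 * x$2) * y$1"
    by (simp_all add: D_def algebra_simps)
  then have "n$1 * D = 0" "n$2 * D = 0" unfolding nx ny by simp_all
  moreover have "n$1 \<noteq> 0 \<or> n$2 \<noteq> 0" using assms(1) by (auto simp: vec_eq_iff forall_2)
  ultimately have "D = 0" by auto
  moreover have "(x \<bullet> y)\<^sup>2 + D\<^sup>2 = (x \<bullet> x) * (y \<bullet> y)"
    by (simp add: D_def inner_vec_def sum_2 power2_eq_square algebra_simps)
  moreover have xx: "x \<bullet> x = 1" "y \<bullet> y = 1" using assms(4,5) by (simp_all add: dot_square_norm)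
  ultimately have "(x \<bullet> y)\<^sup>2 = 1" by simp
  then have "x \<bullet> y = 1 \<or> x \<bullet> y = - 1" by (simp add: power2_eq_1_iff)
  then have "(x - y) \<bullet> (x - y) = 0 \<or> (x + y) \<bullet> (x + y) = 0"
    using xx by (auto simp: inner_diff_left inner_diff_right inner_add_left inner_add_right inner_commute[of y x])
  then show ?thesis by (auto simp: eq_neg_iff_add_eq_0)
qed

theorem proposition2:
  fixes M Q :: "(real^3) set" and A0 B0 C0 D0 P A' B' C' D' :: "real^3"
    and K1 wA wB wC wD :: real
  assumes "convex_surface M" and "C2_surface M" and "complete M"
    and "0 < K1" and "\<forall>p\<in>M. K1 < gauss_curvature M p" and "bounded (gauss_curvature M ` M)"
    and "convex_quadrilateral M Q A0 B0 C0 D0"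
    and "\<exists>z\<in>M. Q \<subseteq> geodesic_disc M z (injectivity_radius M)"
    and "perimeter M A0 B0 C0 D0 < 2 * injectivity_radius M"
    and "0 < wA" "0 < wB" "0 < wC" "0 < wD"
    and "FT_point M A0 B0 C0 D0 wA wB wC wD P"
    and "P \<in> top_of_set M interior_of Q"
    and "tangent_ray_point M P A0 wA A'" and "tangent_ray_point M P B0 wB B'"
    and "tangent_ray_point M P C0 wC C'" and "tangent_ray_point M P D0 wD D'"
  shows "parallelogram (- A') B' (- C') D'"
proof -
  note C2 = \<open>C2_surface M\<close> and w = \<open>0 < wA\<close> \<open>0 < wB\<close> \<open>0 < wC\<close> \<open>0 < wD\<close>
    and P_int = \<open>P \<in> top_of_set M interior_of Q\<close>
    and rays = \<open>tangent_ray_point M P A0 wA A'\<close> \<open>tangent_ray_point M P B0 wB B'\<close>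
      \<open>tangent_ray_point M P C0 wC C'\<close> \<open>tangent_ray_point M P D0 wD D'\<close>
  have P_in: "P \<in> M" using \<open>FT_point M A0 B0 C0 D0 wA wB wC wD P\<close> by (simp add: FT_point_def)
  have sum: "A' + B' + C' + D' = 0"
    by (rule FT_point_tangent_sum_eq_0[OF C2 \<open>FT_point M A0 B0 C0 D0 wA wB wC wD P\<close> w rays])
  moreover have "\<not> collinear {- A', B', - C'}"
  proof
    assume col: "collinear {- A', B', - C'}"
    let ?F = "top_of_set M frontier_of Q"
    from \<open>convex_quadrilateral M Q A0 B0 C0 D0\<close>
    obtain gab lab gbc lbc gc lcd gda lda where
      cl: "closedin (top_of_set M) Q" and conv: "geodesically_convex M Q" and dist: "distinct [A0, B0, C0, D0]"
      and arcs: "shortest_arc M gab lab A0 B0" "shortest_arc M gbc lbc B0 C0"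
        "shortest_arc M gc lcd C0 D0" "shortest_arc M gda lda D0 A0"
      and corners: "gda ` {0..lda} \<inter> gab ` {0..lab} = {A0}" "gab ` {0..lab} \<inter> gbc ` {0..lbc} = {B0}"
        "gbc ` {0..lbc} \<inter> gc ` {0..lcd} = {C0}" "gc ` {0..lcd} \<inter> gda ` {0..lda} = {D0}"
        "gab ` {0..lab} \<inter> gc ` {0..lcd} = {}" "gbc ` {0..lbc} \<inter> gda ` {0..lda} = {}"
      and F: "?F = gab ` {0..lab} \<union> gbc ` {0..lbc} \<union> gc ` {0..lcd} \<union> gda ` {0..lda}"
      unfolding convex_quadrilateral_def Let_def by (elim exE conjE) (rule that; assumption)
    define m where "m = (lab + lbc + lcd + lda) / 2"
    have m0: "0 \<le> m" using arcs[THEN shortest_arc_geodist(3)] by (simp add: m_def)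
    have vertices: "A0 \<in> ?F" "B0 \<in> ?F" "C0 \<in> ?F" "D0 \<in> ?F" unfolding F using corners by blast+
    have close: "geodist M x y \<le> ennreal m" if "x \<in> ?F" "y \<in> ?F" for x y
    proof -
      from that(1) consider "x \<in> gab ` {0..lab}" | "x \<in> gbc ` {0..lbc}" | "x \<in> gc ` {0..lcd}" | "x \<in> gda ` {0..lda}"
        unfolding F by blast
      then show ?thesis
        using that(2) unfolding F m_def
        by cases (use quadrilateral_boundary_dist_le[OF arcs(1,2,3,4), of x y]
            quadrilateral_boundary_dist_le[OF arcs(2,3,4,1), of x y]
            quadrilateral_boundary_dist_le[OF arcs(3,4,1,2), of x y]
            quadrilateral_boundary_dist_le[OF arcs(4,1,2,3), of x y] in \<open>auto simp: ac_simps\<close>)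
    qed
    obtain R where R: "m < R" "\<And>x. x \<in> M \<Longrightarrow> \<exists>r\<ge>R. normal_radius M x r"
      using uniform_normal_radius[OF quadrilateral_half_perimeter_less[OF arcs assms(9)]] m0 unfolding m_def by blast
    have R0: "0 < R" using R(1) m0 by simp
    have charts: "\<exists>J E. polar_chart M x R J E" if "x \<in> M" for x
      using R(2)[OF that] polar_chart_exists[OF C2 that _ R0] by metis
    obtain J E where chart: "polar_chart M P R J E" using charts[OF P_in] by blast
    have J: "linear J" "\<And>x. norm (J x) = norm x" "range J = tangent_plane M P"
      using chart unfolding polar_chart_def by blast+
    obtain \<sigma> where \<sigma>: "continuous_on (sphere 0 1) \<sigma>" "inj_on \<sigma> (sphere 0 1)" "\<sigma> ` sphere 0 1 = ?F"
      and \<sigma>_arc: "\<And>x g l q. q \<in> ?F \<Longrightarrow> shortest_arc M g l P q \<Longrightarrow> 0 < l \<Longrightarrow> norm x = 1 \<Longrightarrow>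
        (g has_vector_derivative J x) (at 0 within {0..l}) \<Longrightarrow> \<sigma> x = q"
      using boundary_radial_homeomorphism[OF charts chart P_int conv cl _ close m0 R(1)] vertices by blast
    have direction: "\<exists>x. norm x = 1 \<and> V' = J (wV *\<^sub>R x) \<and> \<sigma> x = V"
      if V: "V \<in> ?F" "tangent_ray_point M P V wV V'" "0 < wV" for V wV V'
    proof -
      obtain g l u where g: "shortest_arc M g l P V" "0 < l" "norm u = 1"
        "(g has_vector_derivative u) (at 0 within {0..l})" and u: "V' = wV *\<^sub>R u"
        by (rule tangent_ray_pointE[OF C2 P_in V(2,3)])
      have "V' \<in> range J" using V(2) unfolding J(3) tangent_ray_point_def by blast
      then obtain v where v: "V' = J v" by blast
      define x where "x = v /\<^sub>R wV"
      have "J x = V' /\<^sub>R wV" by (simp add: x_def v linear_scale[OF J(1)])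
      then have Jx: "J x = u" using u V(3) by simp
      then have "norm x = 1" using J(2)[of x] g(3) by simp
      moreover have "V' = J (wV *\<^sub>R x)" using v V(3) by (simp add: x_def)
      moreover have "\<sigma> x = V" using \<sigma>_arc[OF V(1) g(1,2) \<open>norm x = 1\<close>] g(4) Jx by simp
      ultimately show ?thesis by blast
    qed
    obtain a where a: "norm a = 1" "A' = J (wA *\<^sub>R a)" "\<sigma> a = A0" using direction[OF vertices(1) rays(1) w(1)] by blast
    obtain b where b: "norm b = 1" "B' = J (wB *\<^sub>R b)" "\<sigma> b = B0" using direction[OF vertices(2) rays(2) w(2)] by blast
    obtain c where c: "norm c = 1" "C' = J (wC *\<^sub>R c)" "\<sigma> c = C0" using direction[OF vertices(3) rays(3) w(3)] by blast
    obtain d where d: "norm d = 1" "D' = J (wD *\<^sub>R d)" "\<sigma> d = D0" using direction[OF vertices(4) rays(4) w(4)] by blast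
    obtain n where n: "n \<noteq> 0" and na: "n \<bullet> (wC *\<^sub>R c) = n \<bullet> (wA *\<^sub>R a)" "n \<bullet> (wB *\<^sub>R b) = - (n \<bullet> (wA *\<^sub>R a))"
        "n \<bullet> (wD *\<^sub>R d) = - (n \<bullet> (wA *\<^sub>R a))"
      by (rule collinear_isometric_image_normal[OF J(1,2), of "wA *\<^sub>R a" "wB *\<^sub>R b" "wC *\<^sub>R c" "wD *\<^sub>R d"])
        (use col sum a(2) b(2) c(2) d(2) in auto)
    \<comment> \<open>the common height of the four vectors over the line with normal \<open>n\<close>\<close>
    define h where "h = n \<bullet> (wA *\<^sub>R a)"
    have dots: "n \<bullet> a = h / wA" "n \<bullet> b = - (h / wB)" "n \<bullet> c = h / wC" "n \<bullet> d = - (h / wD)"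
      using na w by (simp_all add: h_def field_simps)
    have closed_arc: "closed (g ` {0..l})" if "shortest_arc M g l x y" for g l x y
    proof -
      have "1-lipschitz_on {0..l} g"
        using shortest_arc_dist_le[OF that] by (intro lipschitz_onI) (auto simp: dist_norm)
      then have "continuous_on {0..l} g" by (rule lipschitz_on_continuous_on)
      then show ?thesis by (intro compact_imp_closed compact_continuous_image) auto
    qed
    define AB BC CD DA where sides: "AB = gab ` {0..lab}" "BC = gbc ` {0..lbc}" "CD = gc ` {0..lcd}" "DA = gda ` {0..lda}"
    note corners' = corners[folded sides] and F' = F[folded sides]
    have closed: "closed (DA \<union> AB)" "closed (BC \<union> CD)"
      unfolding sides by (rule closed_Un[OF closed_arc[OF arcs(4)] closed_arc[OF arcs(1)]])
        (rule closed_Un[OF closed_arc[OF arcs(2)] closed_arc[OF arcs(3)]])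
    have cover: "\<sigma> ` sphere 0 1 = (DA \<union> AB) \<union> (BC \<union> CD)" unfolding \<sigma>(3) F' by blast
    have opposite: "DA \<inter> BC = {}" "DA \<inter> CD = {D0}" using corners'(4,6) by (simp_all only: Int_commute)
    have meet: "(DA \<union> AB) \<inter> (BC \<union> CD) \<subseteq> {\<sigma> b, \<sigma> d}"
      unfolding b(3) d(3) Int_Un_distrib Int_Un_distrib2 opposite corners'(2,5) by simp
    have "A0 \<in> DA \<inter> AB" "C0 \<in> BC \<inter> CD" unfolding corners'(1,3) by simp_all
    then have mem: "\<sigma> a \<in> DA \<union> AB" "\<sigma> c \<in> BC \<union> CD" unfolding a(3) c(3) by simp_all
    note separation = circle_order_not_separated[OF \<sigma>(1,2) cover closed meet a(1) b(1) c(1) d(1) mem]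
    consider "h = 0" | "0 < h" | "h < 0" by linarith
    then show False
    proof cases
      case 1
      \<comment> \<open>a line through the origin contains only two unit vectors, but the vertices give distinct directions\<close>
      then have "n \<bullet> a = 0" "n \<bullet> b = 0" "n \<bullet> c = 0" using dots by simp_all
      then have "a = b \<or> a = - b" "a = c \<or> a = - c" "b = c \<or> b = - c"
        using unit_vectors_orthogonal_to_normal[OF n] a(1) b(1) c(1) by blast+
      moreover have "a \<noteq> b" "b \<noteq> c" "a \<noteq> c" using dist a(3) b(3) c(3) by auto
      ultimately show False by simp
    next
      case 2
      then show False using separation[of n] dots w by simp
    next
      case 3
      then show False using separation[of "- n"] dots w by (simp add: divide_neg_pos divide_nonpos_pos)
    qed
  qed
  ultimately show ?thesis
    unfolding parallelogram_def by (simp add: algebra_simps eq_neg_iff_add_eq_0)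
qed

end
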